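(* Let $D$ be an open polydisc in $\mathbb{C}^n$ with centre at the origin and let $\Omega$ be a neighborhood of $\overline{D}$. Let $m_1,\dots,m_n\in\mathbb{N}$ and let $F_1,\dots,F_n$ be functions on $\Omega$ defined by $F_j(z)=\bar{z}_j^{\,m_j}+R_j(z)$ for $j=1,\dots,n$, where the map $R=(R_1,\dots,R_n):\Omega\to\mathbb{C}^n$ satisfies, for some $c\in(0,1)$, $$|R(z)-R(\xi)|\le c\left(\sum_{j=1}^n\left|z_j^{m_j}-\xi_j^{m_j}\right|^2\right)^{1/2}\qquad\text{for all } z=(z_1,\dots,z_n),\ \xi=(\xi_1,\dots,\xi_n)\in\Omega .$$ Then the graph $\mathrm{Gr}_{\overline{D}}(F)=\{(z,F_1(z),\dots,F_n(z)):z\in\overline{D}\}\subset\mathbb{C}^{2n}$ of $F=(F_1,\dots,F_n)$ over $\overline{D}$ is polynomially convex. Additionally, if $R$ is $\mathcal{C}^1$-smooth on $\Omega$, then $$[z_1,\dots,z_n,\ \bar{z}_1^{\,m_1}+R_1(z),\dots,\bar{z}_n^{\,m_n}+R_n(z);\ \overline{D}]=\mathcal{C}(\overline{D}).$$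
   Context: $\mathbb{N}$ denotes the positive integers and $|\cdot|$ the Euclidean norm on $\mathbb{C}^n$. $\mathcal{C}(\overline{D})$ is the set of all continuous complex-valued functions on $\overline{D}$. For $f_1,\dots,f_N\in\mathcal{C}(\overline{D})$, $[f_1,\dots,f_N;\overline{D}]$ denotes the uniform algebra generated by $f_1,\dots,f_N$ on $\overline{D}$, i.e. the uniform closure in $\mathcal{C}(\overline{D})$ of the set of complex polynomials in $f_1,\dots,f_N$. For a compact set $K\subset\mathbb{C}^N$, its polynomial convex hull is $\widehat{K}=\{\alpha\in\mathbb{C}^N: |p(\alpha)|\le\max_K|p| \text{ for all } p\in\mathbb{C}[z_1,\dots,z_N]\}$, and $K$ is polynomially convex if $\widehat{K}=K$. *)

theory Defs
  imports "HOL-Analysis.Analysis"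
begin

text \<open>Complex polynomials in the coordinates of \<open>\<complex>\<^sup>N\<close>, as functions: finite sums of
  monomials indexed by multi-indices \<open>a :: 'N \<Rightarrow> nat\<close>.\<close>

definition complex_polynomial :: "(complex ^ 'N \<Rightarrow> complex) \<Rightarrow> bool" where
  "complex_polynomial p \<longleftrightarrow>
     (\<exists>(A :: ('N \<Rightarrow> nat) set) (coef :: ('N \<Rightarrow> nat) \<Rightarrow> complex). finite A \<and>
        p = (\<lambda>z. \<Sum>a\<in>A. coef a * (\<Prod>i\<in>UNIV. (z $ i) ^ a i)))"

text \<open>For compact nonempty \<open>K\<close> the supremum is a maximum.\<close>

definition polynomial_hull :: "(complex ^ 'N) set \<Rightarrow> (complex ^ 'N) set" where
  "polynomial_hull K =
     {\<alpha>. \<forall>p. complex_polynomial p \<longrightarrow> cmod (p \<alpha>) \<le> (SUP z\<in>K. cmod (p z))}"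

definition polynomially_convex :: "(complex ^ 'N) set \<Rightarrow> bool" where
  "polynomially_convex K \<longleftrightarrow> compact K \<and> polynomial_hull K = K"

definition open_polydisc :: "complex ^ 'n \<Rightarrow> ('n \<Rightarrow> real) \<Rightarrow> (complex ^ 'n) set" where
  "open_polydisc a r = {z. \<forall>j. cmod (z $ j - a $ j) < r j}"

text \<open>The pair \<open>(z, w) \<in> \<complex>\<^sup>m \<times> \<complex>\<^sup>n\<close> as a vector of \<open>\<complex>\<^bsup>m+n\<^esup>\<close>, the coordinates
  being indexed by the sum type.\<close>

definition join_vec :: "complex ^ 'm \<Rightarrow> complex ^ 'n \<Rightarrow> complex ^ ('m + 'n)" where
  "join_vec z w = (\<chi> k. case_sum (\<lambda>i. z $ i) (\<lambda>j. w $ j) k)"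

definition graph_over ::
    "(complex ^ 'm) set \<Rightarrow> (complex ^ 'm \<Rightarrow> complex ^ 'n) \<Rightarrow> (complex ^ ('m + 'n)) set" where
  "graph_over K F = (\<lambda>z. join_vec z (F z)) ` K"

text \<open>Functions on \<open>K\<close> are extensional (\<open>undefined\<close> off \<open>K\<close>), as in \<^const>\<open>cfunspace\<close>,
  so that equality of functions is equality on \<open>K\<close>.\<close>

definition continuous_functions :: "'a::topological_space set \<Rightarrow> ('a \<Rightarrow> complex) set" where
  "continuous_functions K = {g \<in> extensional K. continuous_on K g}"

text \<open>The uniform algebra \<open>[f\<^sub>1, \<dots>, f\<^sub>N; K]\<close> for compact \<open>K\<close>: the closure, for the
  supremum metric of \<^const>\<open>cfunspace\<close>, of the polynomials in the \<open>f\<^sub>k\<close>.\<close>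

definition uniform_algebra ::
    "('N::finite \<Rightarrow> 'a::topological_space \<Rightarrow> complex) \<Rightarrow> 'a set \<Rightarrow> ('a \<Rightarrow> complex) set" where
  "uniform_algebra f K =
     mtopology_of (cfunspace (top_of_set K) euclidean_metric) closure_of
       {restrict (\<lambda>z. p (\<chi> k. f k z)) K | p. complex_polynomial p}"

text \<open>\<open>\<C>\<^sup>1\<close>-smoothness in the real sense on an open set: \<open>f'\<close> takes values in the
  bounded real-linear maps, and is continuous for the operator norm.\<close>

definition C1_smooth_on ::
    "'a::real_normed_vector set \<Rightarrow> ('a \<Rightarrow> 'b::real_normed_vector) \<Rightarrow> bool" where
  "C1_smooth_on S f \<longleftrightarrow>
     (\<exists>f' :: 'a \<Rightarrow> 'a \<Rightarrow>\<^sub>L 'b.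
        (\<forall>x\<in>S. (f has_derivative blinfun_apply (f' x)) (at x)) \<and> continuous_on S f')"

lemma continuous_functions_eq_mspace:
  assumes "compact K"
  shows "continuous_functions K = mspace (cfunspace (top_of_set K) euclidean_metric)"
  using assms
  by (auto simp: continuous_functions_def mtopology_of_euclidean compact_imp_bounded
      compact_continuous_image)

end

theory Submission
  imports Defs "HOL-Complex_Analysis.Conformal_Mappings"
begin

text \<open>
  Write \<open>w = (z\<^sub>1^m\<^sub>1, \<dots>, z\<^sub>n^m\<^sub>n)\<close>.  The estimate on \<open>R\<close> says that \<open>R z = G w\<close> for a
  map \<open>G\<close> on the image polydisc \<open>E\<close> which is Lipschitz with constant \<open>c < 1\<close>, so \<open>F z = H w\<close>
  with the contractive perturbation \<open>H w = cnj w + G w\<close> of conjugation.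
  Both conclusions rest on one inequality: for \<open>w, a\<close> in \<open>E\<close>
  \<open>Re (\<Sum>\<^sub>j (w\<^sub>j - a\<^sub>j) (H\<^sub>j w - H\<^sub>j a)) \<ge> (1 - c) |w - a|\<^sup>2\<close>.

  Polynomial convexity (\<open>polynomially_convex_graph\<close>).  Let \<open>(a, b)\<close> be in the hull; then \<open>a\<close> is
  in the polydisc.  With \<open>q\<close> the polynomial on the left, now in the variables \<open>z\<close> and
  \<open>v\<close>, so that \<open>q = \<Sum>\<^sub>j (z\<^sub>j^m\<^sub>j - a\<^sub>j^m\<^sub>j) (v\<^sub>j - F\<^sub>j a)\<close>, the functions
  \<open>exp (- k q) (v\<^sub>j - F\<^sub>j a)\<close> tend to \<open>0\<close> uniformly on the graph as \<open>k\<close> grows, while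
  their value at \<open>(a, b)\<close> is \<open>b\<^sub>j - F\<^sub>j a\<close> for every \<open>k\<close>.  Hence \<open>b = F a\<close>.

  Approximation (\<open>graph_polynomials_dense\<close>).  The heart is that the polynomials in \<open>w\<close> and \<open>H w\<close>
  are dense in the continuous functions on \<open>E\<close>.  In the real coordinates \<open>x\<close> of \<open>w\<close>, the functions
  \<open>(w\<^sub>j + H\<^sub>j w) / 2\<close> and \<open>(w\<^sub>j - H\<^sub>j w) / (2 i)\<close> are the components of a map
  \<open>\<Phi> x = x + A x + i B x\<close> with \<open>|A x - A y| + |B x - B y| \<le> c |x - y|\<close>: the graph is a small complex
  perturbation of real space, and \<open>f\<close> should be recovered by the Gaussian averages
  \<open>(1 / c\<^sub>k) \<integral> f x exp (- k \<Sum>\<^sub>i (P\<^sub>i - \<Phi>\<^sub>i x)\<^sup>2) det (D\<Phi> x) dx\<close> with \<open>P = \<Phi> x\<^sub>0\<close>,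
  which are limits of polynomials in \<open>P\<close>.  In modulus the exponential decays like
  \<open>exp (- k \<kappa> |x - x\<^sub>0|\<^sup>2)\<close> with \<open>\<kappa> > 0\<close>, but it oscillates, and only the complex Jacobian
  determinant makes the averages of the constant \<open>1\<close> equal to \<open>1\<close>.  That normalisation
  (\<open>integral_gaussian_complex_perturbation\<close>) is the ordinary change of variables formula for the
  real maps \<open>x + A x + s B x\<close> with \<open>s\<close> real and small; both sides are entire in \<open>s\<close>, and
  \<open>s = i\<close> is the required case.  Two repairs make this available for Lipschitz data: \<open>\<Phi>\<close> in the kernel
  is replaced by a mollification so close that the kernel does not notice it at scale
  \<open>k\<close> to the power \<open>- 1/2\<close>, and \<open>\<Phi> - P\<close> is cut off far away from \<open>E\<close> with a tiny gradient, so that all maps are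
  the identity outside a large box.  This is
  \<open>poly_approximable_small_lipschitz_perturbation\<close>.

  So all continuous functions of \<open>w\<close> are limits of polynomials on the graph over the polydisc.
  Since \<open>cnj z\<^sub>j\<close> is the uniform limit of
  \<open>z\<^sub>j^(m\<^sub>j - 1) cnj (z\<^sub>j^m\<^sub>j) / (|z\<^sub>j|\<^sup>2 + \<epsilon>\<^sup>2)^(m\<^sub>j - 1)\<close>, the product of a power of \<open>z\<^sub>j\<close> and a
  continuous function of \<open>w\<close>, the conjugates are limits of polynomials as well, and the
  Stone-Weierstrass theorem finishes the proof.
\<close>

section \<open>Polynomials in several variables and uniform approximation\<close>

lemma complex_polynomial_monomial:
  "complex_polynomial (\<lambda>z :: complex ^ 'N. c * (\<Prod>i\<in>UNIV. (z $ i) ^ a i))"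
  unfolding complex_polynomial_def
  by (rule exI[of _ "{a}"], rule exI[of _ "\<lambda>_. c"]) auto

lemma complex_polynomial_const: "complex_polynomial (\<lambda>z :: complex ^ 'N. c)"
  using complex_polynomial_monomial[of c "\<lambda>_. 0"] by simp

lemma complex_polynomial_add:
  assumes "complex_polynomial p" "complex_polynomial q"
  shows "complex_polynomial (\<lambda>z. p z + q z)"
proof -
  obtain A c where A: "finite A" "p = (\<lambda>z. \<Sum>a\<in>A. c a * (\<Prod>i\<in>UNIV. (z $ i) ^ a i))"
    using assms(1) unfolding complex_polynomial_def by blast
  obtain B d where B: "finite B" "q = (\<lambda>z. \<Sum>a\<in>B. d a * (\<Prod>i\<in>UNIV. (z $ i) ^ a i))"
    using assms(2) unfolding complex_polynomial_def by blast
  let ?e = "\<lambda>a. (if a \<in> A then c a else 0) + (if a \<in> B then d a else 0)"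
  have "(\<Sum>a\<in>A \<union> B. ?e a * (\<Prod>i\<in>UNIV. (z $ i) ^ a i)) = p z + q z" for z
  proof -
    have "(\<Sum>a\<in>A \<union> B. ?e a * (\<Prod>i\<in>UNIV. (z $ i) ^ a i))
        = (\<Sum>a\<in>A \<union> B. if a \<in> A then c a * (\<Prod>i\<in>UNIV. (z $ i) ^ a i) else 0)
        + (\<Sum>a\<in>A \<union> B. if a \<in> B then d a * (\<Prod>i\<in>UNIV. (z $ i) ^ a i) else 0)"
      unfolding sum.distrib[symmetric] by (rule sum.cong) (auto simp: algebra_simps)
    also have "\<dots> = p z + q z"
      using A(1) B(1) unfolding A(2) B(2) by (simp add: sum.If_cases Int_absorb1)
    finally show ?thesis .
  qed
  then show ?thesis unfolding complex_polynomial_def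
    using A(1) B(1) by (intro exI[of _ "A \<union> B"] exI[of _ ?e]) auto
qed

lemma complex_polynomial_sum:
  assumes "\<And>i. i \<in> I \<Longrightarrow> complex_polynomial (p i)"
  shows "complex_polynomial (\<lambda>z. \<Sum>i\<in>I. p i z)"
  using assms
  by (induction I rule: infinite_finite_induct)
     (auto intro: complex_polynomial_add complex_polynomial_const)

lemma complex_polynomial_mult:
  assumes "complex_polynomial p" "complex_polynomial q"
  shows "complex_polynomial (\<lambda>z :: complex ^ 'N. p z * q z)"
proof -
  obtain A c where A: "p = (\<lambda>z. \<Sum>a\<in>A. c a * (\<Prod>i\<in>UNIV. (z $ i) ^ a i))"
    using assms(1) unfolding complex_polynomial_def by blast
  obtain B d where B: "q = (\<lambda>z. \<Sum>a\<in>B. d a * (\<Prod>i\<in>UNIV. (z $ i) ^ a i))"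
    using assms(2) unfolding complex_polynomial_def by blast
  have "p z * q z =
      (\<Sum>a\<in>A. \<Sum>b\<in>B. (c a * d b) * (\<Prod>i\<in>UNIV. (z $ i) ^ (a i + b i)))" for z
    unfolding A B sum_product by (simp add: power_add prod.distrib algebra_simps)
  then show ?thesis
    by (simp add: complex_polynomial_sum complex_polynomial_monomial)
qed

lemma complex_polynomial_prod:
  assumes "\<And>i. i \<in> I \<Longrightarrow> complex_polynomial (p i)"
  shows "complex_polynomial (\<lambda>z. \<Prod>i\<in>I. p i z)"
  using assms
  by (induction I rule: infinite_finite_induct)
     (auto intro: complex_polynomial_mult complex_polynomial_const)

lemma complex_polynomial_power:
  assumes "complex_polynomial p"
  shows "complex_polynomial (\<lambda>z. p z ^ k)"
  by (induction k) (auto intro: complex_polynomial_mult complex_polynomial_const assms)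

lemma complex_polynomial_coord: "complex_polynomial (\<lambda>z :: complex ^ 'N. z $ i)"
proof -
  have "(\<Prod>j\<in>UNIV. (z $ j) ^ (if j = i then 1 else 0)) = z $ i" for z :: "complex ^ 'N"
    by (simp add: if_distrib[of "power _"] cong: if_cong)
  then show ?thesis
    using complex_polynomial_monomial[of 1 "\<lambda>j. if j = i then 1 else 0"] by simp
qed

lemma complex_polynomial_compose:
  assumes "complex_polynomial p" "\<And>i. complex_polynomial (g i)"
  shows "complex_polynomial (\<lambda>z. p (\<chi> i. g i z))"
proof -
  obtain A c where A: "p = (\<lambda>z. \<Sum>a\<in>A. c a * (\<Prod>i\<in>UNIV. (z $ i) ^ a i))"
    using assms(1) unfolding complex_polynomial_def by blast
  show ?thesis unfolding A
    by (auto intro!: complex_polynomial_sum complex_polynomial_mult complex_polynomial_const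
        complex_polynomial_prod complex_polynomial_power assms(2))
qed

lemma continuous_on_complex_polynomial:
  assumes "complex_polynomial p"
  shows "continuous_on S p"
proof -
  obtain A c where A: "p = (\<lambda>z. \<Sum>a\<in>A. c a * (\<Prod>i\<in>UNIV. (z $ i) ^ a i))"
    using assms(1) unfolding complex_polynomial_def by blast
  show ?thesis unfolding A by (intro continuous_intros)
qed

text \<open>
  Membership in a uniform algebra, phrased for functions on the whole type instead of extensional ones,
  so that sums, products and limits can be taken without restricting them to \<open>K\<close> each time.
\<close>

definition poly_approximable :: "'a set \<Rightarrow> ('a \<Rightarrow> complex ^ 'N) \<Rightarrow> ('a \<Rightarrow> complex) \<Rightarrow> bool" where
  "poly_approximable K \<Phi> f \<longleftrightarrow>
     (\<forall>e>0. \<exists>p. complex_polynomial p \<and> (\<forall>x\<in>K. cmod (p (\<Phi> x) - f x) < e))"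

lemma poly_approximable_polynomial:
  "complex_polynomial p \<Longrightarrow> poly_approximable K \<Phi> (\<lambda>x. p (\<Phi> x))"
  unfolding poly_approximable_def by force

lemma poly_approximable_limit:
  assumes "\<And>e. e > 0 \<Longrightarrow> \<exists>g. poly_approximable K \<Phi> g \<and> (\<forall>x\<in>K. cmod (g x - f x) < e)"
  shows "poly_approximable K \<Phi> f"
  unfolding poly_approximable_def
proof (intro allI impI)
  fix e :: real assume "e > 0"
  then obtain g where g: "poly_approximable K \<Phi> g" "\<forall>x\<in>K. cmod (g x - f x) < e/2"
    using assms[of "e/2"] by auto
  then obtain p where p: "complex_polynomial p" "\<forall>x\<in>K. cmod (p (\<Phi> x) - g x) < e/2"
    using \<open>e > 0\<close> unfolding poly_approximable_def by (meson half_gt_zero)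
  have "cmod (p (\<Phi> x) - f x) < e" if "x \<in> K" for x
    using norm_triangle_lt[of "p (\<Phi> x) - g x" "g x - f x" e] p(2) g(2) that by fastforce
  with p(1) show "\<exists>p. complex_polynomial p \<and> (\<forall>x\<in>K. cmod (p (\<Phi> x) - f x) < e)" by blast
qed

lemma poly_approximable_add:
  assumes "poly_approximable K \<Phi> f" "poly_approximable K \<Phi> g"
  shows "poly_approximable K \<Phi> (\<lambda>x. f x + g x)"
  unfolding poly_approximable_def
proof (intro allI impI)
  fix e :: real assume "e > 0"
  obtain p where p: "complex_polynomial p" "\<forall>x\<in>K. cmod (p (\<Phi> x) - f x) < e/2"
    using assms(1) \<open>e > 0\<close> unfolding poly_approximable_def by (meson half_gt_zero)
  obtain q where q: "complex_polynomial q" "\<forall>x\<in>K. cmod (q (\<Phi> x) - g x) < e/2"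
    using assms(2) \<open>e > 0\<close> unfolding poly_approximable_def by (meson half_gt_zero)
  have "cmod (p (\<Phi> x) + q (\<Phi> x) - (f x + g x)) < e" if "x \<in> K" for x
    using norm_triangle_lt[of "p (\<Phi> x) - f x" "q (\<Phi> x) - g x" e] p(2) q(2) that
    by (fastforce simp: algebra_simps)
  then show "\<exists>p. complex_polynomial p \<and> (\<forall>x\<in>K. cmod (p (\<Phi> x) - (f x + g x)) < e)"
    using complex_polynomial_add[OF p(1) q(1)] by blast
qed

lemma poly_approximable_mult:
  assumes f: "poly_approximable K \<Phi> f" "bounded (f ` K)"
    and g: "poly_approximable K \<Phi> g" "bounded (g ` K)"
  shows "poly_approximable K \<Phi> (\<lambda>x. f x * g x)"
  unfolding poly_approximable_def
proof (intro allI impI)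
  fix e :: real assume "e > 0"
  obtain M where M: "M > 0" "\<And>x. x \<in> K \<Longrightarrow> cmod (f x) \<le> M"
    using f(2) by (auto simp: bounded_pos)
  obtain N where N: "N > 0" "\<And>x. x \<in> K \<Longrightarrow> cmod (g x) \<le> N"
    using g(2) by (auto simp: bounded_pos)
  define d where "d = min 1 (e / (2 * (M + N + 1)))"
  have d: "d > 0" "d \<le> 1" "d * (M + N + 1) < e"
  proof -
    show "d > 0" "d \<le> 1" using \<open>e > 0\<close> M(1) N(1) by (auto simp: d_def)
    have "d * (M + N + 1) \<le> e / (2 * (M + N + 1)) * (M + N + 1)"
      using M(1) N(1) by (intro mult_right_mono) (auto simp: d_def)
    also have "\<dots> = e / 2" using M(1) N(1) by (simp add: field_simps)
    also have "\<dots> < e" using \<open>e > 0\<close> by simp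
    finally show "d * (M + N + 1) < e" .
  qed
  obtain p where p: "complex_polynomial p" "\<forall>x\<in>K. cmod (p (\<Phi> x) - f x) < d"
    using f(1) d(1) unfolding poly_approximable_def by meson
  obtain q where q: "complex_polynomial q" "\<forall>x\<in>K. cmod (q (\<Phi> x) - g x) < d"
    using g(1) d(1) unfolding poly_approximable_def by meson
  have "cmod (p (\<Phi> x) * q (\<Phi> x) - f x * g x) < e" if "x \<in> K" for x
  proof -
    let ?a = "p (\<Phi> x) - f x" and ?b = "q (\<Phi> x) - g x"
    have "p (\<Phi> x) * q (\<Phi> x) - f x * g x = ?a * ?b + ?a * g x + f x * ?b"
      by (simp add: algebra_simps)
    then have "cmod (p (\<Phi> x) * q (\<Phi> x) - f x * g x)
        \<le> cmod ?a * cmod ?b + cmod ?a * cmod (g x) + cmod (f x) * cmod ?b"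
      by (metis (no_types, lifting) norm_mult norm_triangle_ineq norm_triangle_le add_mono order_refl)
    also have "\<dots> \<le> d * 1 + d * N + M * d"
      using p(2) q(2) that M N d by (intro add_mono mult_mono) (auto intro: less_imp_le order_trans)
    also have "\<dots> < e" using d(3) by (simp add: algebra_simps)
    finally show ?thesis .
  qed
  then show "\<exists>p. complex_polynomial p \<and> (\<forall>x\<in>K. cmod (p (\<Phi> x) - (f x * g x)) < e)"
    using complex_polynomial_mult[OF p(1) q(1)] by blast
qed

section \<open>A Gaussian integral over a complex perturbation of real space\<close>

text \<open>
  The converse of the mean value inequality: the increment quotients in direction \<open>h\<close> are bounded by
  \<open>l |h|\<close>, hence so is their limit.
\<close>

lemma lipschitz_derivative_bound:
  fixes f :: "'a::real_normed_vector \<Rightarrow> 'b::real_normed_vector"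
  assumes der: "(f has_derivative f') (at x)"
    and lip: "\<And>y. norm (f y - f x) \<le> l * norm (y - x)"
  shows "norm (f' h) \<le> l * norm h"
proof -
  interpret bounded_linear f' using der by (rule has_derivative_bounded_linear)
  have "norm (f' h) \<le> (l + e) * norm h" if "e > 0" for e
  proof -
    obtain d where d: "d > 0"
      "\<And>y. norm (y - x) < d \<Longrightarrow> norm (f y - f x - f' (y - x)) \<le> e * norm (y - x)"
      using der \<open>e > 0\<close> unfolding has_derivative_at_alt by blast
    define t where "t = d / (2 * (norm h + 1))"
    have t: "t > 0" using d(1) by (simp add: t_def add_nonneg_pos)
    have "t * norm h \<le> t * (norm h + 1)" using t by (intro mult_left_mono) auto
    also have "t * (norm h + 1) = d / 2"
      using norm_ge_zero[of h] unfolding t_def by (simp add: field_simps add_nonneg_eq_0_iff)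
    finally have "norm (t *\<^sub>R h) < d" using t d(1) by simp
    then have "norm (f (x + t *\<^sub>R h) - f x - f' (t *\<^sub>R h)) \<le> e * norm (t *\<^sub>R h)"
      using d(2)[of "x + t *\<^sub>R h"] by simp
    moreover have "norm (f (x + t *\<^sub>R h) - f x) \<le> l * norm (t *\<^sub>R h)"
      using lip[of "x + t *\<^sub>R h"] by simp
    ultimately have "norm (f' (t *\<^sub>R h)) \<le> (l + e) * norm (t *\<^sub>R h)"
      using norm_triangle_ineq2[of "f' (t *\<^sub>R h)" "f (x + t *\<^sub>R h) - f x"]
      by (simp add: norm_minus_commute algebra_simps)
    then show ?thesis using t by (simp add: scaleR)
  qed
  then have "norm (f' h) \<le> l * norm h + e" if "e > 0" for e
  proof -
    have "norm (f' h) \<le> (l + e / (norm h + 1)) * norm h"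
      using that by (intro \<open>\<And>e. e > 0 \<Longrightarrow> norm (f' h) \<le> (l + e) * norm h\<close>) (simp add: add_nonneg_pos)
    also have "\<dots> \<le> l * norm h + e"
      using that norm_ge_zero[of h] by (simp add: algebra_simps divide_le_eq add_nonneg_pos
          not_less add_nonneg_nonneg)
    finally show ?thesis .
  qed
  then show ?thesis by (rule field_le_epsilon)
qed

text \<open>
  Along the segment from the identity to \<open>1 + M\<close> no matrix has a kernel, so the determinant keeps
  the sign that it has at the identity.
\<close>

lemma det_perturbation_pos:
  fixes M :: "real ^ 'm ^ 'm"
  assumes "\<And>h. norm (M *v h) \<le> l * norm h" "l < 1"
  shows "det (mat 1 + M) > 0"
proof (rule ccontr)
  assume "\<not> det (mat 1 + M) > 0"
  moreover have "continuous_on {0..1} (\<lambda>t. det (mat 1 + t *\<^sub>R M))"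
    unfolding det_def by (intro continuous_intros)
  ultimately obtain t where t: "t \<in> {0..1}" "det (mat 1 + t *\<^sub>R M) = 0"
    using IVT2'[of "\<lambda>t. det (mat 1 + t *\<^sub>R M)" 1 0 0] by force
  then have "\<not> (\<exists>B. B ** (mat 1 + t *\<^sub>R M) = mat 1)"
    using invertible_det_nz[of "mat 1 + t *\<^sub>R M"] invertible_left_inverse[of "mat 1 + t *\<^sub>R M"]
    by simp
  then obtain v where v: "v \<noteq> 0" "(mat 1 + t *\<^sub>R M) *v v = 0"
    unfolding matrix_left_invertible_ker by auto
  from v(2) have "v + t *\<^sub>R (M *v v) = 0"
    by (simp add: matrix_vector_mult_add_rdistrib scaleR_matrix_vector_assoc)
  then have "v = - (t *\<^sub>R (M *v v))" by (rule eq_neg_iff_add_eq_0[THEN iffD2])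
  then have "norm v = norm (t *\<^sub>R (M *v v))" by (metis norm_minus_cancel)
  also have "\<dots> = t * norm (M *v v)" using t by simp
  also have "\<dots> \<le> 1 * (l * norm v)" using t assms(1) by (intro mult_mono) auto
  finally show False using v(1) assms(2) by simp
qed

text \<open>
  The map \<open>x + \<Psi> x\<close> is a bijection of the space by the contraction principle, and it fixes every
  point off the box, so it permutes the box.  Its Jacobian determinant is positive; what remains is
  the change of variables formula.
\<close>

lemma integral_compact_perturbation:
  fixes \<Psi> :: "real ^ 'm::{finite,wellorder} \<Rightarrow> real ^ 'm::_" and f :: "real ^ 'm::_ \<Rightarrow> real"
  assumes der: "\<And>x. (\<Psi> has_derivative (\<lambda>h. D x *v h)) (at x)"
    and lip: "\<And>x y. norm (\<Psi> x - \<Psi> y) \<le> l * norm (x - y)" and l: "0 \<le> l" "l < 1"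
    and supp: "\<And>x. x \<notin> cbox a b \<Longrightarrow> \<Psi> x = 0"
    and f: "continuous_on (cbox a b) f"
  shows "integral (cbox a b) (\<lambda>x. f (x + \<Psi> x) * det (mat 1 + D x)) = integral (cbox a b) f"
proof -
  define g where "g x = x + \<Psi> x" for x
  have inj: "inj g"
  proof (rule injI)
    fix x y assume "g x = g y"
    then have "x - y = - (\<Psi> x - \<Psi> y)" by (simp add: g_def algebra_simps)
    then have "norm (x - y) \<le> l * norm (x - y)" using lip[of x y] by (metis norm_minus_cancel)
    then have "(1 - l) * norm (x - y) \<le> 0" by (simp add: algebra_simps)
    then have "norm (x - y) \<le> 0" using l by (simp add: mult_le_0_iff)
    then show "x = y" by simp
  qed
  have surj: "\<exists>x. g x = y" for y
  proof -
    have "\<exists>!x. y - \<Psi> x = x"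
      by (rule banach_fix_type[OF l])
         (use lip in \<open>auto simp: dist_norm norm_minus_commute\<close>)
    then obtain x where "y - \<Psi> x = x" by blast
    then have "g x = y" by (simp add: g_def algebra_simps eq_diff_eq diff_eq_eq)
    then show ?thesis ..
  qed
  have out: "g x = x" if "x \<notin> cbox a b" for x using supp[OF that] by (simp add: g_def)
  have img: "g ` cbox a b = cbox a b"
  proof
    show "g ` cbox a b \<subseteq> cbox a b"
    proof (rule image_subsetI, rule ccontr)
      fix x assume x: "x \<in> cbox a b" "g x \<notin> cbox a b"
      then have "g (g x) = g x" using out by blast
      then have "g x = x" by (rule injD[OF inj])
      with x show False by simp
    qed
    show "cbox a b \<subseteq> g ` cbox a b"
    proof
      fix y assume y: "y \<in> cbox a b"
      obtain x where x: "g x = y" using surj by blast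
      then have "x \<in> cbox a b" using out[of x] y by force
      with x show "y \<in> g ` cbox a b" by blast
    qed
  qed
  have derg: "(g has_derivative (\<lambda>h. (mat 1 + D x) *v h)) (at x within cbox a b)" for x
    unfolding g_def
    by (rule has_derivative_eq_rhs[OF has_derivative_add[OF has_derivative_ident
            has_derivative_at_withinI[OF der]]])
       (simp add: matrix_vector_mult_add_rdistrib)
  have det: "\<bar>det (mat 1 + D x)\<bar> = det (mat 1 + D x)" for x
    using det_perturbation_pos[of "D x" l] lipschitz_derivative_bound[OF der lip] l by simp
  define F :: "real ^ 'm::_ \<Rightarrow> real ^ 1" where "F x = vec (f x)" for x
  have "continuous_on (cbox a b) F"
    unfolding F_def vec_def by (intro continuous_on_vec_lambda f)
  then have "F absolutely_integrable_on cbox a b"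
    by (rule absolutely_integrable_continuous)
  moreover have "inj_on g (cbox a b)" using inj by (rule inj_on_subset) simp
  ultimately have "integral (cbox a b) (\<lambda>x. \<bar>det (matrix (\<lambda>h. (mat 1 + D x) *v h))\<bar> *\<^sub>R F (g x))
       = integral (cbox a b) F"
    and int: "(\<lambda>x. \<bar>det (matrix (\<lambda>h. (mat 1 + D x) *v h))\<bar> *\<^sub>R F (g x)) absolutely_integrable_on cbox a b"
    using has_absolute_integral_change_of_variables[of "cbox a b" g "\<lambda>x h. (mat 1 + D x) *v h" F]
      derg img by auto
  then have eq: "integral (cbox a b) (\<lambda>x. det (mat 1 + D x) *\<^sub>R F (g x)) = integral (cbox a b) F"
    and int': "(\<lambda>x. det (mat 1 + D x) *\<^sub>R F (g x)) integrable_on cbox a b"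
    unfolding matrix_of_matrix_vector_mul det absolutely_integrable_on_def by blast+
  have intF: "F integrable_on cbox a b"
    using \<open>F absolutely_integrable_on cbox a b\<close> by (rule set_lebesgue_integral_eq_integral(1))
  have "integral (cbox a b) (\<lambda>x. (det (mat 1 + D x) *\<^sub>R F (g x)) $ 1) = integral (cbox a b) (\<lambda>x. F x $ 1)"
    unfolding integral_component_eq_cart[OF int'] integral_component_eq_cart[OF intF] eq ..
  moreover have "(det (mat 1 + D x) *\<^sub>R F (g x)) $ 1 = f (x + \<Psi> x) * det (mat 1 + D x)" for x
    unfolding F_def g_def vector_scaleR_component vec_component by (simp only: real_scaleR_def mult.commute)
  moreover have "F x $ 1 = f x" for x by (simp only: F_def vec_component)
  ultimately show ?thesis by (simp only:)
qed

text \<open>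
  The properties of an integrand depending on a complex parameter \<open>s\<close> that allow differentiation under the
  integral; as a predicate closed under sums, products and the exponential, it spares the explicit
  derivative of a determinant.
\<close>

definition entire_family :: "'b::topological_space set \<Rightarrow> (complex \<Rightarrow> 'b \<Rightarrow> complex) \<Rightarrow> bool" where
  "entire_family T g \<longleftrightarrow>
     (\<exists>g'. (\<forall>s. \<forall>x\<in>T. ((\<lambda>s. g s x) has_field_derivative g' s x) (at s)) \<and>
        continuous_on (UNIV \<times> T) (\<lambda>(s, x). g s x) \<and>
        continuous_on (UNIV \<times> T) (\<lambda>(s, x). g' s x))"

lemma entire_family_affine:
  assumes "continuous_on T u" "continuous_on T v"
  shows "entire_family T (\<lambda>s x. u x + s * v x)"
  unfolding entire_family_def
proof (intro exI[of _ "\<lambda>s x. v x"] conjI allI ballI)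
  have [continuous_intros]: "continuous_on (UNIV \<times> T) (\<lambda>p. u (snd p))"
    "continuous_on (UNIV \<times> T) (\<lambda>p. v (snd p))"
    by (auto intro!: continuous_on_compose2[OF assms(1)] continuous_on_compose2[OF assms(2)]
        continuous_intros)
  show "continuous_on (UNIV \<times> T) (\<lambda>(s, x). u x + s * v x)"
    and "continuous_on (UNIV \<times> T) (\<lambda>(s, x). v x)"
    by (auto simp: case_prod_unfold intro!: continuous_intros)
  show "((\<lambda>s. u x + s * v x) has_field_derivative v x) (at s)" for s x
    by (auto intro!: derivative_eq_intros)
qed

lemma entire_family_const: "entire_family T (\<lambda>s x. c)"
  using entire_family_affine[of T "\<lambda>_. c" "\<lambda>_. 0"] by simp

lemma entire_family_add:
  assumes "entire_family T f" "entire_family T g"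
  shows "entire_family T (\<lambda>s x. f s x + g s x)"
proof -
  obtain f' where f': "\<And>s x. x \<in> T \<Longrightarrow> ((\<lambda>s. f s x) has_field_derivative f' s x) (at s)"
    "continuous_on (UNIV \<times> T) (\<lambda>(s, x). f s x)" "continuous_on (UNIV \<times> T) (\<lambda>(s, x). f' s x)"
    using assms(1) unfolding entire_family_def by blast
  obtain g' where g': "\<And>s x. x \<in> T \<Longrightarrow> ((\<lambda>s. g s x) has_field_derivative g' s x) (at s)"
    "continuous_on (UNIV \<times> T) (\<lambda>(s, x). g s x)" "continuous_on (UNIV \<times> T) (\<lambda>(s, x). g' s x)"
    using assms(2) unfolding entire_family_def by blast
  show ?thesis unfolding entire_family_def
    using f'(2,3) g'(2,3)
    by (intro exI[of _ "\<lambda>s x. f' s x + g' s x"] conjI allI ballI DERIV_add f'(1) g'(1))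
       (auto simp: case_prod_unfold intro!: continuous_intros)
qed

lemma entire_family_mult:
  assumes "entire_family T f" "entire_family T g"
  shows "entire_family T (\<lambda>s x. f s x * g s x)"
proof -
  obtain f' where f': "\<And>s x. x \<in> T \<Longrightarrow> ((\<lambda>s. f s x) has_field_derivative f' s x) (at s)"
    "continuous_on (UNIV \<times> T) (\<lambda>(s, x). f s x)" "continuous_on (UNIV \<times> T) (\<lambda>(s, x). f' s x)"
    using assms(1) unfolding entire_family_def by blast
  obtain g' where g': "\<And>s x. x \<in> T \<Longrightarrow> ((\<lambda>s. g s x) has_field_derivative g' s x) (at s)"
    "continuous_on (UNIV \<times> T) (\<lambda>(s, x). g s x)" "continuous_on (UNIV \<times> T) (\<lambda>(s, x). g' s x)"
    using assms(2) unfolding entire_family_def by blast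
  show ?thesis unfolding entire_family_def
    using f'(2,3) g'(2,3)
    by (intro exI[of _ "\<lambda>s x. f' s x * g s x + g' s x * f s x"] conjI allI ballI DERIV_mult f'(1) g'(1))
       (auto simp: case_prod_unfold intro!: continuous_intros)
qed

lemma entire_family_exp:
  assumes "entire_family T f"
  shows "entire_family T (\<lambda>s x. exp (f s x))"
proof -
  obtain f' where f': "\<And>s x. x \<in> T \<Longrightarrow> ((\<lambda>s. f s x) has_field_derivative f' s x) (at s)"
    "continuous_on (UNIV \<times> T) (\<lambda>(s, x). f s x)" "continuous_on (UNIV \<times> T) (\<lambda>(s, x). f' s x)"
    using assms(1) unfolding entire_family_def by blast
  show ?thesis unfolding entire_family_def
    using f'(2,3)
    by (intro exI[of _ "\<lambda>s x. exp (f s x) * f' s x"] conjI allI ballI DERIV_fun_exp f'(1))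
       (auto simp: case_prod_unfold intro!: continuous_intros)
qed

lemma entire_family_sum:
  "(\<And>i. i \<in> I \<Longrightarrow> entire_family T (f i)) \<Longrightarrow> entire_family T (\<lambda>s x. \<Sum>i\<in>I. f i s x)"
  by (induction I rule: infinite_finite_induct)
     (auto intro: entire_family_const entire_family_add)

lemma entire_family_prod:
  "(\<And>i. i \<in> I \<Longrightarrow> entire_family T (f i)) \<Longrightarrow> entire_family T (\<lambda>s x. \<Prod>i\<in>I. f i s x)"
  by (induction I rule: infinite_finite_induct)
     (auto intro: entire_family_const entire_family_mult)

lemma entire_family_det:
  assumes "\<And>i j. entire_family T (\<lambda>s x. M s x $ i $ j)"
  shows "entire_family T (\<lambda>s x. det (M s x))"
  unfolding det_def
  by (intro entire_family_sum entire_family_mult entire_family_const entire_family_prod assms)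

lemma entire_family_integral:
  assumes "entire_family (cbox a b) g"
  shows "(\<lambda>s. integral (cbox a b) (g s)) holomorphic_on UNIV"
proof -
  obtain g' where g': "\<And>s x. x \<in> cbox a b \<Longrightarrow> ((\<lambda>s. g s x) has_field_derivative g' s x) (at s)"
    "continuous_on (UNIV \<times> cbox a b) (\<lambda>(s, x). g s x)"
    "continuous_on (UNIV \<times> cbox a b) (\<lambda>(s, x). g' s x)"
    using assms unfolding entire_family_def by blast
  have "continuous_on (cbox a b) (g s)" for s
    using continuous_on_compose2[OF g'(2), of "cbox a b" "\<lambda>x. (s, x)"]
    by (simp add: continuous_on_Pair image_subset_iff)
  then show ?thesis
    using g' by (intro leibniz_rule_holomorphic[where fx = g'])
      (auto intro: integrable_continuous)
qed

lemma det_of_real: "det (\<chi> i j. complex_of_real (M $ i $ j)) = complex_of_real (det M)"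
  by (simp add: det_def)

text \<open>
  Replace the imaginary unit in front of \<open>B\<close> by a parameter \<open>s\<close>.  For real \<open>s\<close> with \<open>|s| \<le> 1\<close> the
  map \<open>x + A x + s B x\<close> is a contractive perturbation of the identity and the claim is
  the change of variables formula; both sides are entire in \<open>s\<close>.  This is the cancellation
  on which the approximation theorem depends, and which an estimate of absolute values cannot give.
\<close>

lemma integral_gaussian_complex_perturbation:
  fixes A B :: "real ^ 'm::{finite,wellorder} \<Rightarrow> real ^ 'm::_"
  assumes A: "\<And>x. (A has_derivative (\<lambda>h. DA x *v h)) (at x)" "continuous_on UNIV DA"
    and B: "\<And>x. (B has_derivative (\<lambda>h. DB x *v h)) (at x)" "continuous_on UNIV DB"
    and lip: "\<And>x y. norm (A x - A y) + norm (B x - B y) \<le> l * norm (x - y)"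
    and l: "0 \<le> l" "l < 1"
    and supp: "\<And>x. x \<notin> cbox a b \<Longrightarrow> A x = 0" "\<And>x. x \<notin> cbox a b \<Longrightarrow> B x = 0"
  shows "integral (cbox a b) (\<lambda>x.
        exp (- of_real k * (\<Sum>i\<in>UNIV. (Complex (x $ i + A x $ i) (B x $ i))\<^sup>2))
        * det (\<chi> i j. Complex ((mat 1 + DA x) $ i $ j) (DB x $ i $ j)))
      = of_real (integral (cbox a b) (\<lambda>x. exp (- k * (norm x)\<^sup>2)))"
proof -
  define g where "g s x = exp (- of_real k * (\<Sum>i\<in>UNIV. (of_real (x $ i + A x $ i) + s * of_real (B x $ i))\<^sup>2))
        * det (\<chi> i j. of_real ((mat 1 + DA x) $ i $ j) + s * of_real (DB x $ i $ j))" for s :: complex and x :: "real ^ 'm::_"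
  define c where "c = integral (cbox a b) (\<lambda>x. exp (- k * (norm x)\<^sup>2))"
  have cA [continuous_intros]: "continuous_on S A" and cB [continuous_intros]: "continuous_on S B" for S
    using A(1) B(1) by (meson continuous_at_imp_continuous_on has_derivative_continuous)+
  have cDA [continuous_intros]: "continuous_on S DA" and cDB [continuous_intros]: "continuous_on S DB" for S
    using A(2) B(2) continuous_on_subset by blast+
  have "entire_family (cbox a b) g"
  proof -
    have row: "entire_family (cbox a b) (\<lambda>s x. complex_of_real (x $ i + A x $ i) + s * of_real (B x $ i))" for i
      by (rule entire_family_affine) (intro continuous_intros)+
    have entry: "entire_family (cbox a b)
        (\<lambda>s x. complex_of_real ((mat 1 + DA x) $ i $ j) + s * of_real (DB x $ i $ j))" for i j
      by (rule entire_family_affine) (intro continuous_intros)+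
    have "entire_family (cbox a b)
        (\<lambda>s x. det (\<chi> i j. complex_of_real ((mat 1 + DA x) $ i $ j) + s * of_real (DB x $ i $ j)))"
      using entry by (intro entire_family_det) simp
    moreover have "entire_family (cbox a b) (\<lambda>s x. exp (- complex_of_real k *
        (\<Sum>i\<in>UNIV. (of_real (x $ i + A x $ i) + s * of_real (B x $ i))\<^sup>2)))"
      unfolding power2_eq_square
      by (rule entire_family_exp, rule entire_family_mult, rule entire_family_const,
          rule entire_family_sum, rule entire_family_mult; rule row)
    ultimately show ?thesis unfolding g_def by (intro entire_family_mult)
  qed
  then have hol: "(\<lambda>s. integral (cbox a b) (g s) - of_real c) holomorphic_on UNIV"
    by (intro holomorphic_on_diff entire_family_integral holomorphic_on_const)
  have real: "integral (cbox a b) (g (of_real t)) - of_real c = 0" if t: "\<bar>t\<bar> \<le> 1" for t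
  proof -
    let ?\<Psi> = "\<lambda>x. A x + t *\<^sub>R B x" and ?D = "\<lambda>x. DA x + t *\<^sub>R DB x"
    have "integral (cbox a b) (\<lambda>x. exp (- k * (norm (x + ?\<Psi> x))\<^sup>2) * det (mat 1 + ?D x)) = c"
      unfolding c_def
    proof (rule integral_compact_perturbation[where l = l and f = "\<lambda>x. exp (- k * (norm x)\<^sup>2)"])
      show "(?\<Psi> has_derivative (*v) (?D x)) (at x)" for x
        by (rule has_derivative_eq_rhs[OF has_derivative_add[OF A(1) has_derivative_scaleR_right[OF B(1)]]])
           (simp add: fun_eq_iff matrix_vector_mult_add_rdistrib scaleR_matrix_vector_assoc)
      show "norm (?\<Psi> x - ?\<Psi> y) \<le> l * norm (x - y)" for x y
      proof -
        have "norm (?\<Psi> x - ?\<Psi> y) = norm ((A x - A y) + t *\<^sub>R (B x - B y))"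
          by (simp add: algebra_simps)
        also have "\<dots> \<le> norm (A x - A y) + \<bar>t\<bar> * norm (B x - B y)"
          by (metis norm_scaleR norm_triangle_ineq)
        also have "\<dots> \<le> norm (A x - A y) + 1 * norm (B x - B y)"
          using t by (intro add_left_mono mult_right_mono) auto
        finally show ?thesis using lip[of x y] by simp
      qed
    qed (use l supp in \<open>auto intro!: continuous_intros\<close>)
    moreover have geq: "g (of_real t) = (\<lambda>x. of_real (exp (- k * (norm (x + ?\<Psi> x))\<^sup>2) * det (mat 1 + ?D x)))"
    proof
      fix x
      have "det (\<chi> i j. complex_of_real ((mat 1 + DA x) $ i $ j) + of_real t * of_real (DB x $ i $ j))
          = of_real (det (mat 1 + ?D x))"
        unfolding det_of_real[symmetric] by (simp add: add.assoc)
      moreover have "(norm (x + ?\<Psi> x))\<^sup>2 = (\<Sum>i\<in>UNIV. (x $ i + A x $ i + t * B x $ i)\<^sup>2)"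
        unfolding power2_norm_eq_inner inner_vec_def by (simp add: power2_eq_square add.assoc)
      moreover have "(\<Sum>i\<in>UNIV. (complex_of_real (x $ i + A x $ i) + of_real t * of_real (B x $ i))\<^sup>2)
          = of_real (\<Sum>i\<in>UNIV. (x $ i + A x $ i + t * B x $ i)\<^sup>2)"
        unfolding of_real_sum of_real_power of_real_add of_real_mult ..
      ultimately show "g (of_real t) x = of_real (exp (- k * (norm (x + ?\<Psi> x))\<^sup>2) * det (mat 1 + ?D x))"
        unfolding g_def by (simp only: of_real_minus[symmetric] of_real_mult[symmetric] exp_of_real)
    qed
    moreover have "(\<lambda>x. exp (- k * (norm (x + ?\<Psi> x))\<^sup>2) * det (mat 1 + ?D x)) integrable_on cbox a b"
      unfolding det_def by (intro integrable_continuous continuous_intros)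
    then have "((\<lambda>x. complex_of_real (exp (- k * (norm (x + ?\<Psi> x))\<^sup>2) * det (mat 1 + ?D x)))
        has_integral of_real (integral (cbox a b)
          (\<lambda>x. exp (- k * (norm (x + ?\<Psi> x))\<^sup>2) * det (mat 1 + ?D x)))) (cbox a b)"
      by (intro has_integral_of_real integrable_integral)
    ultimately have "(g (of_real t) has_integral of_real c) (cbox a b)"
      by (simp only:)
    then show ?thesis by (simp add: integral_unique)
  qed
  have "(0::complex) islimpt of_real ` {0<..1}"
    unfolding islimpt_approachable
  proof (intro allI impI)
    fix e :: real assume "e > 0"
    then show "\<exists>x'\<in>complex_of_real ` {0<..1}. x' \<noteq> 0 \<and> dist x' 0 < e"
      by (intro bexI[of _ "of_real (min 1 (e/2))"]) (auto simp: dist_norm)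
  qed
  note lim = this
  have "integral (cbox a b) (g \<i>) - of_real c = 0"
    by (rule analytic_continuation[OF hol open_UNIV connected_UNIV subset_UNIV UNIV_I lim _ UNIV_I])
       (use real in auto)
  moreover have "g \<i> = (\<lambda>x. exp (- of_real k * (\<Sum>i\<in>UNIV. (Complex (x $ i + A x $ i) (B x $ i))\<^sup>2))
        * det (\<chi> i j. Complex ((mat 1 + DA x) $ i $ j) (DB x $ i $ j)))"
    unfolding g_def Complex_eq by auto
  ultimately show ?thesis unfolding c_def by simp
qed

section \<open>Smoothing by convolution\<close>

text \<open>
  The square makes the positive part continuously differentiable.
\<close>

definition bump :: "'a::euclidean_space \<Rightarrow> real" where
  "bump x = (max 0 (1 - (norm x)\<^sup>2))\<^sup>2"

lemma bump_nonneg: "0 \<le> bump x"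
  by (simp add: bump_def)

lemma bump_eq_0: "1 \<le> norm x \<Longrightarrow> bump x = 0"
  by (simp add: bump_def max_def power_le_one_iff)

lemma continuous_on_bump: "continuous_on S bump"
  unfolding bump_def by (intro continuous_intros)

lemma bump_eq_0_outside_cbox:
  assumes "x \<notin> cbox (- One) One"
  shows "bump x = 0"
proof (rule bump_eq_0)
  obtain i where i: "i \<in> Basis" "\<bar>x \<bullet> i\<bar> > 1"
    using assms by (force simp: mem_box)
  then show "1 \<le> norm x" using Basis_le_norm[of i x] by linarith
qed

lemma has_derivative_bump:
  "(bump has_derivative (\<lambda>h. (- 4 * max 0 (1 - (norm x)\<^sup>2)) * (x \<bullet> h))) (at x)"
proof -
  have pos: "((\<lambda>t. (max 0 t)\<^sup>2) has_real_derivative 2 * max 0 t) (at t)" for t :: real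
  proof -
    consider "t > 0" | "t < 0" | "t = 0" by linarith
    then show ?thesis
    proof cases
      case 1
      have "((\<lambda>t. t\<^sup>2) has_real_derivative 2 * max 0 t) (at t)"
        using 1 by (auto intro!: derivative_eq_intros)
      then show ?thesis
        by (rule has_field_derivative_transform_within_open[where S = "{0<..}"]) (use 1 in auto)
    next
      case 2
      have "((\<lambda>t. 0) has_real_derivative 2 * max 0 t) (at t)"
        using 2 by (auto intro!: derivative_eq_intros)
      then show ?thesis
        by (rule has_field_derivative_transform_within_open[where S = "{..<0}"]) (use 2 in auto)
    next
      case 3
      have "(\<lambda>h::real. ((max 0 h)\<^sup>2) / h) \<midarrow>0\<rightarrow> 0"
      proof (rule Lim_null_comparison)
        show "\<forall>\<^sub>F h in at 0. norm (((max 0 h)\<^sup>2) / h) \<le> \<bar>h\<bar>"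
          by (rule always_eventually) (auto simp: max_def power2_eq_square)
        show "(\<lambda>h. \<bar>h\<bar>) \<midarrow>0\<rightarrow> (0::real)" by (auto intro!: tendsto_eq_intros)
      qed
      then show ?thesis using 3 by (simp add: DERIV_def)
    qed
  qed
  have "((\<lambda>x. 1 - x \<bullet> x) has_derivative (\<lambda>h. - 2 * (x \<bullet> h))) (at x)"
    by (auto intro!: derivative_eq_intros simp: inner_commute)
  then have "((\<lambda>x. (max 0 (1 - x \<bullet> x))\<^sup>2) has_derivative
      (\<lambda>h. (- 2 * (x \<bullet> h)) * (2 * max 0 (1 - x \<bullet> x)))) (at x)"
    by (rule has_derivative_eq_rhs[OF has_derivative_compose[OF _ pos[unfolded has_field_derivative_def]]])
       (simp add: fun_eq_iff)
  then show ?thesis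
    unfolding bump_def power2_norm_eq_inner by (simp add: algebra_simps)
qed

lemma integrable_continuous_compact_support:
  fixes f :: "'a::euclidean_space \<Rightarrow> 'b::euclidean_space"
  assumes "continuous_on UNIV f" "\<And>x. x \<notin> cbox a b \<Longrightarrow> f x = 0"
  shows "f integrable_on UNIV"
proof -
  have "f integrable_on cbox a b"
    by (rule integrable_continuous) (rule continuous_on_subset[OF assms(1) subset_UNIV])
  then show ?thesis
    using assms(2) has_integral_on_superset[of f _ "cbox a b" UNIV] unfolding integrable_on_def by blast
qed

lemma bump_integrable: "(bump :: 'a::euclidean_space \<Rightarrow> real) integrable_on UNIV"
  by (rule integrable_continuous_compact_support[OF continuous_on_bump bump_eq_0_outside_cbox])

lemma bump_scaleR_integrable:
  fixes f :: "'a::euclidean_space \<Rightarrow> 'b::euclidean_space"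
  assumes "continuous_on UNIV f"
  shows "(\<lambda>y. bump y *\<^sub>R f y) integrable_on UNIV"
  by (rule integrable_continuous_compact_support[where a = "- One" and b = One])
     (auto intro!: continuous_intros continuous_on_bump assms simp: bump_eq_0_outside_cbox)

lemma bump_integral_pos: "0 < integral UNIV (bump :: 'a::euclidean_space \<Rightarrow> real)"
proof (rule ccontr)
  let ?C = "cbox (- One) One :: 'a set"
  assume "\<not> ?thesis"
  moreover have "0 \<le> integral UNIV (bump :: 'a \<Rightarrow> real)"
    by (rule integral_nonneg[OF bump_integrable]) (simp add: bump_nonneg)
  ultimately have 0: "(bump has_integral 0) (UNIV :: 'a set)"
    using bump_integrable by (metis integrable_integral less_eq_real_def)
  have "(bump has_integral 0) ?C"
  proof -
    have "(\<lambda>x::'a. if x \<in> ?C then bump x else 0) = bump"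
      by (rule ext) (simp add: bump_eq_0_outside_cbox)
    then show ?thesis using has_integral_restrict_UNIV[of ?C bump 0] 0 by simp
  qed
  note int = this
  have "0 \<in> box (- One) (One :: 'a)" by (simp add: mem_box)
  then have ne: "box (- One) (One :: 'a) \<noteq> {}" by blast
  have "bump (0::'a) = 0"
    by (rule has_integral_0_cbox_imp_0[OF continuous_on_bump _ int ne]) (auto simp: bump_nonneg mem_box)
  then show False by (simp add: bump_def)
qed

definition mollify :: "real \<Rightarrow> ('a::euclidean_space \<Rightarrow> 'b::euclidean_space) \<Rightarrow> 'a \<Rightarrow> 'b" where
  "mollify d f x =
     (1 / integral UNIV (bump :: 'a \<Rightarrow> real)) *\<^sub>R integral UNIV (\<lambda>y. bump y *\<^sub>R f (x - d *\<^sub>R y))"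

lemma mollify_shift:
  fixes f :: "'a::euclidean_space \<Rightarrow> 'b::euclidean_space"
  assumes f: "continuous_on UNIV f"
  shows "continuous_on UNIV (\<lambda>y. f (x - d *\<^sub>R y))"
  by (rule continuous_on_compose2[OF f]) (auto intro!: continuous_intros)

lemma mollify_const: "mollify d (\<lambda>_. c) (x :: 'a::euclidean_space) = c"
proof -
  have "integral UNIV (\<lambda>y::'a. bump y *\<^sub>R c) = integral UNIV (bump :: 'a \<Rightarrow> real) *\<^sub>R c"
    by (rule integral_unique[OF has_integral_scaleR_left[OF integrable_integral[OF bump_integrable]]])
  then show ?thesis
    using bump_integral_pos[where 'a = 'a] by (simp add: mollify_def)
qed

lemma mollify_diff:
  assumes "continuous_on UNIV f" "continuous_on UNIV g"
  shows "mollify d f x - mollify d g x' =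
    (1 / integral UNIV (bump :: 'a::euclidean_space \<Rightarrow> real)) *\<^sub>R
      integral UNIV (\<lambda>y::'a. bump y *\<^sub>R (f (x - d *\<^sub>R y) - g (x' - d *\<^sub>R y)))"
  unfolding mollify_def scaleR_right_diff_distrib
  by (subst integral_diff)
     (auto intro!: bump_scaleR_integrable mollify_shift assms simp: scaleR_right_diff_distrib)

text \<open>
  The sum of two norms is estimated at once, because the hypothesis of contraction below bounds
  \<open>|A x - A y| + |B x - B y|\<close> and both maps are smoothed with the same kernel.
\<close>

lemma norm_mollify_diff_add_le:
  fixes f f' :: "'a::euclidean_space \<Rightarrow> 'b::euclidean_space" and g g' :: "'a \<Rightarrow> 'c::euclidean_space"
  assumes cont: "continuous_on UNIV f" "continuous_on UNIV f'" "continuous_on UNIV g" "continuous_on UNIV g'"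
    and le: "\<And>y. norm y \<le> 1 \<Longrightarrow> norm (f (x - d *\<^sub>R y) - f' (x' - d *\<^sub>R y))
        + norm (g (x - d *\<^sub>R y) - g' (x' - d *\<^sub>R y)) \<le> e"
  shows "norm (mollify d f x - mollify d f' x') + norm (mollify d g x - mollify d g' x') \<le> e"
proof -
  let ?I = "integral UNIV (bump :: 'a \<Rightarrow> real)"
  let ?u = "\<lambda>y. f (x - d *\<^sub>R y) - f' (x' - d *\<^sub>R y)"
  let ?v = "\<lambda>y. g (x - d *\<^sub>R y) - g' (x' - d *\<^sub>R y)"
  have u: "continuous_on UNIV ?u" and v: "continuous_on UNIV ?v"
    using mollify_shift cont by (auto intro!: continuous_on_diff)
  have iu: "(\<lambda>y. bump y *\<^sub>R norm (?u y)) integrable_on UNIV"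
    and iv: "(\<lambda>y. bump y *\<^sub>R norm (?v y)) integrable_on UNIV"
    by (intro bump_scaleR_integrable continuous_on_norm u v)+
  have "norm (integral UNIV (\<lambda>y. bump y *\<^sub>R ?u y)) \<le> integral UNIV (\<lambda>y. bump y *\<^sub>R norm (?u y))"
    by (rule integral_norm_bound_integral[OF bump_scaleR_integrable[OF u] iu]) (simp add: bump_nonneg)
  moreover have "norm (integral UNIV (\<lambda>y. bump y *\<^sub>R ?v y)) \<le> integral UNIV (\<lambda>y. bump y *\<^sub>R norm (?v y))"
    by (rule integral_norm_bound_integral[OF bump_scaleR_integrable[OF v] iv]) (simp add: bump_nonneg)
  moreover have "integral UNIV (\<lambda>y. bump y *\<^sub>R norm (?u y)) + integral UNIV (\<lambda>y. bump y *\<^sub>R norm (?v y))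
      = integral UNIV (\<lambda>y. bump y *\<^sub>R (norm (?u y) + norm (?v y)))"
    unfolding scaleR_add_right by (rule integral_add[OF iu iv, symmetric])
  moreover have "\<dots> \<le> integral UNIV (\<lambda>y::'a. bump y *\<^sub>R e)"
  proof (rule integral_le)
    show "(\<lambda>y. bump y *\<^sub>R (norm (?u y) + norm (?v y))) integrable_on UNIV"
      by (intro bump_scaleR_integrable continuous_on_add continuous_on_norm u v)
    show "(\<lambda>y::'a. bump y *\<^sub>R e) integrable_on UNIV"
      by (intro bump_scaleR_integrable continuous_on_const)
    show "bump y *\<^sub>R (norm (?u y) + norm (?v y)) \<le> bump y *\<^sub>R e" for y
    proof (cases "norm y \<le> 1")
      case True
      then show ?thesis using le[OF True] by (simp add: mult_left_mono bump_nonneg)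
    qed (simp add: bump_eq_0)
  qed
  moreover have "integral UNIV (\<lambda>y::'a. bump y *\<^sub>R e) = ?I * e"
    using integral_unique[OF has_integral_scaleR_left[OF integrable_integral[OF bump_integrable[where 'a = 'a]], of e]]
    by simp
  ultimately have "norm (integral UNIV (\<lambda>y. bump y *\<^sub>R ?u y)) + norm (integral UNIV (\<lambda>y. bump y *\<^sub>R ?v y)) \<le> ?I * e"
    by linarith
  then show ?thesis
    unfolding mollify_diff[OF cont(1,2)] mollify_diff[OF cont(3,4)]
    using bump_integral_pos[where 'a = 'a] by (simp add: field_simps)
qed

text \<open>
  The form in which the variable \<open>x\<close> enters through the kernel only, over a box that does not
  depend on \<open>x\<close>: it can be differentiated even if \<open>f\<close> cannot.
\<close>

lemma mollify_eq_scaled_convolution: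
  fixes f :: "'a::euclidean_space \<Rightarrow> 'b::euclidean_space"
  assumes f: "continuous_on UNIV f" "\<And>x. x \<notin> cbox a b \<Longrightarrow> f x = 0" and d: "d > 0"
  shows "mollify d f x = (1 / (integral UNIV (bump :: 'a \<Rightarrow> real) * d ^ DIM('a))) *\<^sub>R
      integral (cbox a b) (\<lambda>u. bump ((x - u) /\<^sub>R d) *\<^sub>R f u)"
proof -
  let ?k = "\<lambda>u. bump ((x - u) /\<^sub>R d) *\<^sub>R f u"
  have "continuous_on (cbox a b) ?k"
    by (intro continuous_intros continuous_on_compose2[OF continuous_on_bump[of UNIV]]
        continuous_on_subset[OF f(1)] subset_UNIV)
  then have "(?k has_integral integral (cbox a b) ?k) (cbox a b)"
    by (intro integrable_integral integrable_continuous)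
  from has_integral_affinity[OF this, of "- d" x]
  have "((\<lambda>y. ?k (- d *\<^sub>R y + x)) has_integral (1 / d ^ DIM('a)) *\<^sub>R integral (cbox a b) ?k)
      ((\<lambda>u. (1 / - d) *\<^sub>R u + - ((1 / - d) *\<^sub>R x)) ` cbox a b)"
    using d by simp
  moreover have "?k (- d *\<^sub>R y + x) = bump y *\<^sub>R f (x - d *\<^sub>R y)" for y
    using d by simp
  ultimately have "((\<lambda>y. bump y *\<^sub>R f (x - d *\<^sub>R y)) has_integral
      (1 / d ^ DIM('a)) *\<^sub>R integral (cbox a b) ?k) ((\<lambda>u. (1 / - d) *\<^sub>R u + - ((1 / - d) *\<^sub>R x)) ` cbox a b)"
    by (simp only:)
  then have "((\<lambda>y. bump y *\<^sub>R f (x - d *\<^sub>R y)) has_integral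
      (1 / d ^ DIM('a)) *\<^sub>R integral (cbox a b) ?k) UNIV"
  proof (rule has_integral_on_superset)
    fix y assume y: "y \<notin> (\<lambda>u. (1 / - d) *\<^sub>R u + - ((1 / - d) *\<^sub>R x)) ` cbox a b"
    have "x - d *\<^sub>R y \<notin> cbox a b"
    proof
      assume "x - d *\<^sub>R y \<in> cbox a b"
      moreover have "y = (1 / - d) *\<^sub>R (x - d *\<^sub>R y) + - ((1 / - d) *\<^sub>R x)"
        using d by (simp add: algebra_simps)
      ultimately show False using y by blast
    qed
    then show "bump y *\<^sub>R f (x - d *\<^sub>R y) = 0" using f(2) by simp
  qed simp
  then show ?thesis unfolding mollify_def by (simp add: integral_unique)
qed

lemma mollify_C1:
  fixes f :: "real ^ 'm \<Rightarrow> real ^ 'n"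
  assumes f: "continuous_on UNIV f" "\<And>x. x \<notin> cbox a b \<Longrightarrow> f x = 0" and d: "d > 0"
  obtains D where "continuous_on UNIV D" "\<And>x. (mollify d f has_derivative (\<lambda>h. D x *v h)) (at x)"
proof -
  define c where "c = 1 / (integral UNIV (bump :: real ^ 'm \<Rightarrow> real) * d ^ DIM(real ^ 'm))"
  define G where "G x u = (- 4 * max 0 (1 - (norm ((x - u) /\<^sub>R d))\<^sup>2) / d) *\<^sub>R ((x - u) /\<^sub>R d)" for x u :: "real ^ 'm"
  define L where "L x u = blinfun_scaleR_left (f u) o\<^sub>L blinfun_inner_right (G x u)" for x u
  define F where "F x = c *\<^sub>R integral (cbox a b) (L x)" for x
  have mollify: "mollify d f = (\<lambda>x. c *\<^sub>R integral (cbox a b) (\<lambda>u. bump ((x - u) /\<^sub>R d) *\<^sub>R f u))"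
    unfolding c_def by (rule ext) (rule mollify_eq_scaled_convolution[OF f d])
  have cf: "continuous_on S f" for S using f(1) continuous_on_subset by blast
  have cL: "continuous_on (UNIV \<times> cbox a b) (\<lambda>(x, u). L x u)"
    unfolding L_def G_def case_prod_unfold
    by (intro continuous_intros bounded_linear.continuous_on[OF bounded_linear_blinfun_scaleR_left]
        bounded_linear.continuous_on[OF bounded_linear_blinfun_inner_right]
        continuous_on_compose2[OF f(1)]) (use d in auto)
  have deriv: "((\<lambda>x. bump ((x - u) /\<^sub>R d) *\<^sub>R f u) has_derivative blinfun_apply (L x u)) (at x)" for x u
  proof -
    have "((\<lambda>x. (x - u) /\<^sub>R d) has_derivative (\<lambda>h. h /\<^sub>R d)) (at x)"
      by (auto intro!: derivative_eq_intros)
    from has_derivative_scaleR_left[OF has_derivative_compose[OF this has_derivative_bump]]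
    have "((\<lambda>x. bump ((x - u) /\<^sub>R d) *\<^sub>R f u) has_derivative
        (\<lambda>h. ((- 4 * max 0 (1 - (norm ((x - u) /\<^sub>R d))\<^sup>2)) * (((x - u) /\<^sub>R d) \<bullet> (h /\<^sub>R d))) *\<^sub>R f u)) (at x)" .
    moreover have "(- 4 * M) * (w \<bullet> (h /\<^sub>R d)) = ((- 4 * M / d) *\<^sub>R w) \<bullet> h" for M and w h :: "real ^ 'm"
      by (simp add: divide_inverse)
    ultimately show ?thesis
      unfolding L_def G_def blinfun_compose.rep_eq o_def blinfun_scaleR_left.rep_eq blinfun_inner_right.rep_eq
      by (simp only:)
  qed
  have "((\<lambda>x. integral (cbox a b) (\<lambda>u. bump ((x - u) /\<^sub>R d) *\<^sub>R f u)) has_derivative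
      blinfun_apply (integral (cbox a b) (L x))) (at x)" for x
    by (rule leibniz_rule[where U = UNIV, OF _ _ cL])
       (auto intro!: deriv integrable_continuous continuous_intros
         continuous_on_compose2[OF continuous_on_bump[of UNIV]] cf)
  then have F: "(mollify d f has_derivative blinfun_apply (F x)) (at x)" for x
    unfolding mollify F_def
    by (intro has_derivative_eq_rhs[OF has_derivative_scaleR_right]) (auto simp: blinfun.scaleR_left)
  have "continuous_on UNIV (\<lambda>x. integral (cbox a b) (L x))"
    by (rule integral_continuous_on_param) (use cL in simp)
  then have cF: "continuous_on UNIV F" unfolding F_def by (intro continuous_intros)
  show thesis
  proof
    show "continuous_on UNIV (\<lambda>x. matrix (blinfun_apply (F x)))"
      unfolding matrix_def by (intro continuous_on_vec_lambda continuous_intros cF)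
    show "(mollify d f has_derivative (\<lambda>h. matrix (blinfun_apply (F x)) *v h)) (at x)" for x
      using F[of x] by (simp add: matrix_works blinfun.bounded_linear_right bounded_linear.linear)
  qed
qed

lemma mollify_cong:
  assumes "\<And>y. norm y \<le> 1 \<Longrightarrow> f (x - d *\<^sub>R y) = g (x - d *\<^sub>R y)"
  shows "mollify d f x = mollify d g x"
proof -
  have "bump y *\<^sub>R f (x - d *\<^sub>R y) = bump y *\<^sub>R g (x - d *\<^sub>R y)" for y
    using assms[of y] bump_eq_0[of y] by (cases "norm y \<le> 1") auto
  then show ?thesis unfolding mollify_def by (simp only:)
qed

lemma mollify_diff_const:
  assumes "continuous_on UNIV f"
  shows "mollify d (\<lambda>x. f x - c) x = mollify d f x - c"
  using mollify_diff[OF assms continuous_on_const, of d x c x]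
  by (simp add: mollify_const) (simp add: mollify_def)

section \<open>Polynomial approximation and size of Gaussian kernels\<close>

lemma exp_Taylor_uniform:
  assumes "e > 0"
  obtains n where "\<And>z :: complex. norm z \<le> r \<Longrightarrow> norm ((\<Sum>k\<le>n. z ^ k / fact k) - exp z) < e"
proof -
  define q where "q = \<bar>r\<bar>"
  have "(\<lambda>n. q * exp q * (q ^ n / fact n)) \<longlonglongrightarrow> q * exp q * 0"
    using summable_LIMSEQ_zero[OF summable_exp[of q]]
    by (intro tendsto_mult tendsto_const) (simp add: field_simps)
  then have "\<forall>\<^sub>F n in sequentially. q * exp q * (q ^ n / fact n) < e"
    using assms order_tendstoD(2)[of _ "0::real" sequentially e] by simp
  then obtain n where n: "q * exp q * (q ^ n / fact n) < e"
    by (auto simp: eventually_sequentially)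
  have "norm ((\<Sum>k\<le>n. z ^ k / fact k) - exp z) < e" if "norm z \<le> r" for z :: complex
  proof -
    have z: "norm z \<le> q" using that by (simp add: q_def)
    have "norm (exp z - (\<Sum>k\<le>n. z ^ k / fact k)) \<le> exp \<bar>Re z\<bar> * (norm z ^ Suc n) / fact n"
      by (rule Taylor_exp)
    also have "\<dots> \<le> exp q * q ^ Suc n / fact n"
      using z abs_Re_le_cmod[of z] by (intro divide_right_mono mult_mono power_mono) auto
    also have "\<dots> < e" using n by (simp add: mult_ac)
    finally show ?thesis by (simp add: norm_minus_commute)
  qed
  then show thesis using that by blast
qed

text \<open>
  Kernels that are polynomials in \<open>P\<close> with coefficients continuous in the integration variable,
  characterised by their use: integration against a continuous weight gives a polynomial.
  The predicate is only closed under multiplication by coefficients and by coordinates, which is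
  enough to build powers of a quadratic form in \<open>P\<close>.
\<close>

definition poly_kernel ::
    "'b::euclidean_space \<Rightarrow> 'b \<Rightarrow> ('b \<Rightarrow> complex ^ 'N \<Rightarrow> complex) \<Rightarrow> bool" where
  "poly_kernel a b h \<longleftrightarrow> (\<forall>P. continuous_on (cbox a b) (\<lambda>x. h x P)) \<and>
     (\<forall>g. continuous_on (cbox a b) g \<longrightarrow>
        complex_polynomial (\<lambda>P. integral (cbox a b) (\<lambda>x. g x * h x P)))"

lemma poly_kernel_const: "poly_kernel a b (\<lambda>x P. 1)"
  by (simp add: poly_kernel_def complex_polynomial_const continuous_on_const)

lemma poly_kernel_add:
  assumes "poly_kernel a b h" "poly_kernel a b h'"
  shows "poly_kernel a b (\<lambda>x P. h x P + h' x P)"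
  unfolding poly_kernel_def
proof (intro conjI allI impI)
  show "continuous_on (cbox a b) (\<lambda>x. h x P + h' x P)" for P
    using assms by (auto simp: poly_kernel_def intro!: continuous_intros)
  fix g :: "_ \<Rightarrow> complex" assume g: "continuous_on (cbox a b) g"
  have "integral (cbox a b) (\<lambda>x. g x * (h x P + h' x P)) =
      integral (cbox a b) (\<lambda>x. g x * h x P) + integral (cbox a b) (\<lambda>x. g x * h' x P)" for P
    unfolding distrib_left using assms g
    by (intro integral_add integrable_continuous continuous_on_mult) (auto simp: poly_kernel_def)
  then show "complex_polynomial (\<lambda>P. integral (cbox a b) (\<lambda>x. g x * (h x P + h' x P)))"
    using assms g by (simp add: poly_kernel_def complex_polynomial_add)
qed

lemma poly_kernel_cmult:
  assumes "poly_kernel a b h" "continuous_on (cbox a b) u"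
  shows "poly_kernel a b (\<lambda>x P. u x * h x P)"
  unfolding poly_kernel_def
proof (intro conjI allI impI)
  show "continuous_on (cbox a b) (\<lambda>x. u x * h x P)" for P
    using assms by (auto simp: poly_kernel_def intro!: continuous_intros)
  fix g :: "_ \<Rightarrow> complex" assume g: "continuous_on (cbox a b) g"
  then have "continuous_on (cbox a b) (\<lambda>x. g x * u x)"
    using assms by (intro continuous_intros)
  then have "complex_polynomial (\<lambda>P. integral (cbox a b) (\<lambda>x. (g x * u x) * h x P))"
    using assms(1) by (simp add: poly_kernel_def)
  then show "complex_polynomial (\<lambda>P. integral (cbox a b) (\<lambda>x. g x * (u x * h x P)))"
    by (simp add: mult.assoc)
qed

lemma poly_kernel_coord_mult:
  assumes "poly_kernel a b h"
  shows "poly_kernel a b (\<lambda>x P. P $ i * h x P)"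
  unfolding poly_kernel_def
proof (intro conjI allI impI)
  show "continuous_on (cbox a b) (\<lambda>x. P $ i * h x P)" for P
    using assms by (auto simp: poly_kernel_def intro!: continuous_intros)
  fix g :: "_ \<Rightarrow> complex" assume g: "continuous_on (cbox a b) g"
  have "integral (cbox a b) (\<lambda>x. g x * (P $ i * h x P)) = P $ i * integral (cbox a b) (\<lambda>x. g x * h x P)" for P
    unfolding integral_mult_right[symmetric] by (simp add: mult.left_commute)
  then show "complex_polynomial (\<lambda>P. integral (cbox a b) (\<lambda>x. g x * (P $ i * h x P)))"
    using assms g by (simp add: poly_kernel_def complex_polynomial_mult complex_polynomial_coord)
qed

lemma poly_kernel_sum:
  assumes "\<And>i. i \<in> I \<Longrightarrow> poly_kernel a b (h i)"
  shows "poly_kernel a b (\<lambda>x P. \<Sum>i\<in>I. h i x P)"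
  using assms
proof (induction I rule: infinite_finite_induct)
  case empty
  then show ?case using poly_kernel_cmult[OF poly_kernel_const, of a b "\<lambda>_. 0"] by simp
next
  case (infinite I)
  then show ?case using poly_kernel_cmult[OF poly_kernel_const, of a b "\<lambda>_. 0"] by simp
qed (simp add: poly_kernel_add)

text \<open>
  On bounded sets the exponent is bounded, so the exponential may be replaced by a Taylor polynomial,
  uniformly in both variables.
\<close>

lemma poly_approximable_gaussian_integral:
  fixes \<Phi> :: "'b::euclidean_space \<Rightarrow> complex ^ 'N"
  assumes w: "continuous_on (cbox a b) w" and \<Phi>: "continuous_on (cbox a b) \<Phi>"
    and S: "bounded S"
  shows "poly_approximable S (\<lambda>P. P) (\<lambda>P. integral (cbox a b)
           (\<lambda>x. w x * exp (of_real k * (\<Sum>i\<in>UNIV. (P $ i - \<Phi> x $ i)\<^sup>2))))"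
proof -
  define q where "q x P = of_real k * (\<Sum>i\<in>UNIV. (P $ i - \<Phi> x $ i)\<^sup>2)" for x P
  have qcont: "continuous_on (cbox a b) (\<lambda>x. q x P)" for P
    unfolding q_def by (intro continuous_intros \<Phi>)
  have kernel_q: "poly_kernel a b (\<lambda>x P. q x P * h x P)" if "poly_kernel a b h" for h
  proof -
    have lin: "poly_kernel a b (\<lambda>x P. (P $ i - \<Phi> x $ i) * h x P)" if "poly_kernel a b h" for i h
      using poly_kernel_add[OF poly_kernel_coord_mult[OF that, of i]
          poly_kernel_cmult[OF that, of "\<lambda>x. - \<Phi> x $ i"]] \<Phi>
      by (simp add: algebra_simps continuous_intros)
    have "poly_kernel a b (\<lambda>x P. of_real k * (\<Sum>i\<in>UNIV. (P $ i - \<Phi> x $ i) * ((P $ i - \<Phi> x $ i) * h x P)))"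
      by (intro poly_kernel_cmult poly_kernel_sum lin that continuous_on_const)
    then show ?thesis
      by (simp add: q_def power2_eq_square sum_distrib_right mult.assoc)
  qed
  have kernel_pow: "poly_kernel a b (\<lambda>x P. q x P ^ n)" for n
    by (induction n) (auto intro: kernel_q poly_kernel_const)
  have "\<exists>B. \<forall>x\<in>cbox a b. \<forall>P\<in>S. norm (q x P) \<le> B"
  proof -
    obtain B1 where B1: "\<And>P. P \<in> S \<Longrightarrow> norm P \<le> B1" using S by (auto simp: bounded_iff)
    obtain B2 where B2: "\<And>x. x \<in> cbox a b \<Longrightarrow> norm (\<Phi> x) \<le> B2"
      using compact_imp_bounded[OF compact_continuous_image[OF \<Phi> compact_cbox]] by (auto simp: bounded_iff)
    have "norm (q x P) \<le> \<bar>k\<bar> * (\<Sum>i\<in>(UNIV::'N set). (B1 + B2)\<^sup>2)" if "x \<in> cbox a b" "P \<in> S" for x P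
    proof -
      have "norm (P $ i - \<Phi> x $ i) \<le> B1 + B2" for i
        using Finite_Cartesian_Product.norm_nth_le[of P i] Finite_Cartesian_Product.norm_nth_le[of "\<Phi> x" i]
          B1[OF that(2)] B2[OF that(1)] norm_triangle_ineq4[of "P $ i" "\<Phi> x $ i"] by linarith
      then show ?thesis
        unfolding q_def norm_mult norm_of_real
        by (intro mult_left_mono sum_norm_le) (auto simp: norm_power intro!: power_mono)
    qed
    then show ?thesis by blast
  qed
  then obtain B where B: "\<And>x P. x \<in> cbox a b \<Longrightarrow> P \<in> S \<Longrightarrow> norm (q x P) \<le> B" by blast
  obtain W where W: "W > 0" "\<And>x. x \<in> cbox a b \<Longrightarrow> norm (w x) \<le> W"
    using compact_imp_bounded[OF compact_continuous_image[OF w compact_cbox]] by (auto simp: bounded_pos)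
  define c where "c = measure lebesgue (cbox a b)"
  show ?thesis
    unfolding poly_approximable_def q_def[symmetric]
  proof (intro allI impI)
    fix e :: real assume "e > 0"
    have c0: "c \<ge> 0" by (simp add: c_def)
    define e' where "e' = e / (2 * W * (c + 1))"
    have e': "e' > 0" using \<open>e > 0\<close> W(1) c0 by (simp add: e'_def)
    obtain n where n: "\<And>z :: complex. norm z \<le> B \<Longrightarrow> norm ((\<Sum>k\<le>n. z ^ k / fact k) - exp z) < e'"
      using exp_Taylor_uniform[OF e'] by blast
    let ?T = "\<lambda>x P. \<Sum>j\<le>n. (1 / fact j) * q x P ^ j"
    have T: "poly_kernel a b ?T"
      by (intro poly_kernel_sum poly_kernel_cmult kernel_pow continuous_on_const)
    then have poly: "complex_polynomial (\<lambda>P. integral (cbox a b) (\<lambda>x. w x * ?T x P))"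
      using w by (simp add: poly_kernel_def)
    have "norm (integral (cbox a b) (\<lambda>x. w x * ?T x P) - integral (cbox a b) (\<lambda>x. w x * exp (q x P))) < e"
      if P: "P \<in> S" for P
    proof -
      have i1: "(\<lambda>x. w x * ?T x P) integrable_on cbox a b" and i2: "(\<lambda>x. w x * exp (q x P)) integrable_on cbox a b"
        by (intro integrable_continuous continuous_intros w qcont)+
      have "norm (integral (cbox a b) (\<lambda>x. w x * ?T x P - w x * exp (q x P))) \<le> integral (cbox a b) (\<lambda>x. W * e')"
      proof (rule integral_norm_bound_integral)
        show "(\<lambda>x. w x * ?T x P - w x * exp (q x P)) integrable_on cbox a b"
          using i1 i2 by (rule integrable_diff)
        fix x assume x: "x \<in> cbox a b"
        have "norm (w x * ?T x P - w x * exp (q x P)) = norm (w x) * norm (?T x P - exp (q x P))"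
          by (simp add: right_diff_distrib[symmetric] norm_mult)
        also have "\<dots> \<le> W * e'"
          using W(2)[OF x] n[OF B[OF x P]] W(1) by (intro mult_mono) auto
        finally show "norm (w x * ?T x P - w x * exp (q x P)) \<le> W * e'" .
      qed (rule integrable_const)
      also have "integral (cbox a b) (\<lambda>x. W * e') = c * (W * e')" by (simp add: c_def)
      also have "W * e' = e / (2 * (c + 1))" using W(1) by (simp add: e'_def)
      also have "c * \<dots> = e / 2 * (c / (c + 1))" by simp
      also have "\<dots> \<le> e / 2 * 1" using \<open>e > 0\<close> c0 by (intro mult_left_mono) auto
      also have "\<dots> < e" using \<open>e > 0\<close> by simp
      finally show ?thesis using integral_diff[OF i1 i2] by simp
    qed
    then show "\<exists>p. complex_polynomial p \<and> (\<forall>P\<in>S. norm (p P - integral (cbox a b) (\<lambda>x. w x * exp (q x P))) < e)"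
      using poly by blast
  qed
qed

text \<open>
  The point \<open>x + A x + \<i> B x\<close>, with real and imaginary displacement kept apart as real maps.
\<close>

definition perturb :: "(real ^ 'm \<Rightarrow> real ^ 'm) \<Rightarrow> (real ^ 'm \<Rightarrow> real ^ 'm) \<Rightarrow> real ^ 'm \<Rightarrow> complex ^ 'm" where
  "perturb A B x = (\<chi> i. Complex (x $ i + A x $ i) (B x $ i))"

lemma Re_sum_squares:
  "Re (\<Sum>i\<in>UNIV. (Complex (X $ i) (Y $ i))\<^sup>2) = (norm X)\<^sup>2 - (norm (Y :: real ^ 'm))\<^sup>2"
  unfolding power2_norm_eq_inner inner_vec_def by (simp add: power2_eq_square sum_subtractf)

text \<open>
  Here \<open>u\<close> and \<open>v\<close> stand for the norms of the real and imaginary part of a displacement whose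
  source has length \<open>t\<close>, and \<open>\<delta>\<close> for the error of smoothing; the difference of squares is, up to
  the factor \<open>- k\<close>, the real part of the exponent of the Gaussian.
\<close>

lemma square_diff_lower_bound:
  fixes l :: real
  assumes l: "0 \<le> l" "l < 1" and nn: "0 \<le> u" "0 \<le> v" "0 \<le> t"
    and lo: "(1 - l) * t - \<delta> \<le> u - v" and hi: "u + v \<le> 2 * t + \<delta>"
  shows "(1 - l)\<^sup>2 / 2 * t\<^sup>2 - (2 + 2 / (1 - l)) * \<delta>\<^sup>2 \<le> u\<^sup>2 - v\<^sup>2"
proof -
  define k where "k = 1 - l"
  have k: "0 < k" "k \<le> 1" using l by (auto simp: k_def)
  have eq: "u\<^sup>2 - v\<^sup>2 = (u - v) * (u + v)" by (simp add: power2_eq_square algebra_simps)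
  have "k\<^sup>2 / 2 * t\<^sup>2 - (2 + 2 / k) * \<delta>\<^sup>2 \<le> u\<^sup>2 - v\<^sup>2"
  proof (cases "\<delta> \<le> k * t")
    case True
    have "k\<^sup>2 / 2 * t\<^sup>2 - (2 + 2 / k) * \<delta>\<^sup>2 \<le> k\<^sup>2 / 2 * t\<^sup>2 - 1 * \<delta>\<^sup>2"
      using k by (intro diff_left_mono mult_right_mono) auto
    also have "\<dots> \<le> (k * t - \<delta>)\<^sup>2"
      using zero_le_power2[of "k * t - 2 * \<delta>"] by (simp add: power2_eq_square algebra_simps)
    also have "\<dots> \<le> (u - v) * (u - v)"
      unfolding power2_eq_square using True lo by (intro mult_mono) (auto simp: k_def)
    also have "\<dots> \<le> (u - v) * (u + v)"
      using True lo nn by (intro mult_left_mono) (auto simp: k_def)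
    finally show ?thesis using eq by simp
  next
    case False
    moreover have "0 \<le> k * t" using k(1) nn(3) by simp
    ultimately have d: "\<delta> > 0" "k * t < \<delta>" by linarith+
    have t: "t \<le> \<delta> / k" using d k by (simp add: field_simps)
    have "(k * t)\<^sup>2 \<le> \<delta>\<^sup>2" using d k nn by (intro power_mono) auto
    then have 1: "k\<^sup>2 / 2 * t\<^sup>2 \<le> \<delta>\<^sup>2 / 2" by (simp add: power_mult_distrib)
    have "- \<delta> * (2 * (\<delta> / k) + \<delta>) \<le> - \<delta> * (u + v)"
      using d t hi by (intro mult_left_mono_neg) auto
    also have "\<dots> \<le> (u - v) * (u + v)"
    proof (rule mult_right_mono)
      have "0 \<le> k * t" using k(1) nn(3) by simp
      then show "- \<delta> \<le> u - v" using lo by (simp add: k_def)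
    qed (use nn in simp)
    finally have "- \<delta> * (2 * (\<delta> / k) + \<delta>) \<le> u\<^sup>2 - v\<^sup>2" using eq by simp
    moreover define w where "w = (1 + 2 / k) * \<delta>\<^sup>2"
    moreover have "- \<delta> * (2 * (\<delta> / k) + \<delta>) = - w"
      by (simp add: w_def power2_eq_square algebra_simps)
    moreover have "(2 + 2 / k) * \<delta>\<^sup>2 = w + \<delta>\<^sup>2"
      by (simp add: w_def algebra_simps)
    moreover have "0 \<le> \<delta>\<^sup>2" by simp
    ultimately show ?thesis using 1 by linarith
  qed
  then show ?thesis by (simp add: k_def)
qed

lemma integral_gaussian_pos:
  fixes a b :: "'a::euclidean_space"
  assumes "box a b \<noteq> {}"
  shows "0 < integral (cbox a b) (\<lambda>x. exp (- k * (norm x)\<^sup>2))"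
proof (rule ccontr)
  let ?g = "\<lambda>x. exp (- k * (norm x)\<^sup>2)"
  have c: "continuous_on (cbox a b) ?g" by (intro continuous_intros)
  then have i: "(?g has_integral integral (cbox a b) ?g) (cbox a b)"
    by (intro integrable_integral integrable_continuous)
  assume "\<not> 0 < integral (cbox a b) ?g"
  moreover have "0 \<le> integral (cbox a b) ?g"
    using i by (intro integral_nonneg) auto
  ultimately have "(?g has_integral 0) (cbox a b)" using i by simp
  moreover obtain x where "x \<in> box a b" using assms by blast
  ultimately have "?g x = 0"
    using has_integral_0_cbox_imp_0[OF c _ _ assms, of x] box_subset_cbox by force
  then show False by simp
qed

text \<open>
  Substituting \<open>y = \<mu> (x - x\<^sub>0)\<close> turns the left-hand integrand into the right-hand one, and the
  shrunken box stays inside the original one because \<open>\<mu> \<le> 1/2\<close>.  This bounds the absolute mass of the kernel by a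
  multiple of its total integral, uniformly in \<open>k\<close>.
\<close>

lemma integral_scaled_gaussian_le:
  fixes a x0 :: "'a::euclidean_space"
  assumes x0: "x0 \<in> cbox (- a) a" and \<mu>: "0 < \<mu>" "\<mu> \<le> 1 / 2"
  shows "integral (cbox (- a) a) (\<lambda>x. exp (- k * (\<mu>\<^sup>2 * (norm (x - x0))\<^sup>2)))
       \<le> (1 / \<mu> ^ DIM('a)) * integral (cbox (- a) a) (\<lambda>x. exp (- k * (norm x)\<^sup>2))"
proof -
  let ?g = "\<lambda>x::'a. exp (- k * (norm x)\<^sup>2)"
  have c: "continuous_on S ?g" for S by (intro continuous_intros)
  define I where "I = integral (cbox (\<mu> *\<^sub>R (- a - x0)) (\<mu> *\<^sub>R (a - x0))) ?g"
  have "(?g has_integral I) (cbox (\<mu> *\<^sub>R (- a - x0)) (\<mu> *\<^sub>R (a - x0)))"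
    unfolding I_def by (intro integrable_integral integrable_continuous c)
  from has_integral_affinity[OF this, of \<mu> "- \<mu> *\<^sub>R x0"]
  have "((\<lambda>x. ?g (\<mu> *\<^sub>R x + - \<mu> *\<^sub>R x0)) has_integral (1 / \<mu> ^ DIM('a)) * I)
      ((\<lambda>x. (1 / \<mu>) *\<^sub>R x + - ((1 / \<mu>) *\<^sub>R (- \<mu> *\<^sub>R x0))) ` cbox (\<mu> *\<^sub>R (- a - x0)) (\<mu> *\<^sub>R (a - x0)))"
    using \<mu> by simp
  moreover have "(\<lambda>x. (1 / \<mu>) *\<^sub>R x + - ((1 / \<mu>) *\<^sub>R (- \<mu> *\<^sub>R x0))) ` cbox (\<mu> *\<^sub>R (- a - x0)) (\<mu> *\<^sub>R (a - x0)) = cbox (- a) a"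
  proof -
    have "(\<lambda>x. (1 / \<mu>) *\<^sub>R x + - ((1 / \<mu>) *\<^sub>R (- \<mu> *\<^sub>R x0))) = (\<lambda>x. (1 / \<mu>) *\<^sub>R x + x0)"
      using \<mu> by auto
    moreover have "cbox (\<mu> *\<^sub>R (- a - x0)) (\<mu> *\<^sub>R (a - x0)) \<noteq> {}"
      using x0 \<mu> by (auto simp: box_ne_empty mem_box inner_diff_left intro!: mult_left_mono)
    ultimately show ?thesis using \<mu> by (simp only: image_affinity_cbox) simp
  qed
  moreover have "?g (\<mu> *\<^sub>R x + - \<mu> *\<^sub>R x0) = exp (- k * (\<mu>\<^sup>2 * (norm (x - x0))\<^sup>2))" for x
  proof -
    have "\<mu> *\<^sub>R x + - \<mu> *\<^sub>R x0 = \<mu> *\<^sub>R (x - x0)" by (simp add: algebra_simps)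
    then show ?thesis by (simp add: power_mult_distrib)
  qed
  ultimately have "integral (cbox (- a) a) (\<lambda>x. exp (- k * (\<mu>\<^sup>2 * (norm (x - x0))\<^sup>2))) = (1 / \<mu> ^ DIM('a)) * I"
    by (metis (no_types, lifting) integral_unique has_integral_cong)
  moreover have "I \<le> integral (cbox (- a) a) ?g"
    unfolding I_def
  proof (rule integral_subset_le)
    show "cbox (\<mu> *\<^sub>R (- a - x0)) (\<mu> *\<^sub>R (a - x0)) \<subseteq> cbox (- a) a"
    proof (clarsimp simp: mem_box)
      fix x i :: 'a
      assume i: "i \<in> Basis" and x: "\<forall>i\<in>Basis. \<mu> * ((- a - x0) \<bullet> i) \<le> x \<bullet> i \<and> x \<bullet> i \<le> \<mu> * ((a - x0) \<bullet> i)"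
      have a: "- (a \<bullet> i) \<le> x0 \<bullet> i" "x0 \<bullet> i \<le> a \<bullet> i" using x0 i by (auto simp: mem_box)
      have "\<mu> * ((a - x0) \<bullet> i) \<le> (1/2) * (2 * (a \<bullet> i))"
        using a \<mu> by (intro mult_mono) (auto simp: inner_diff_left)
      moreover have "\<mu> * ((a + x0) \<bullet> i) \<le> (1/2) * (2 * (a \<bullet> i))"
        using a \<mu> by (intro mult_mono) (auto simp: inner_add_left)
      moreover have "\<mu> * ((- a - x0) \<bullet> i) = - (\<mu> * ((a + x0) \<bullet> i))"
        by (simp add: inner_diff_left inner_add_left algebra_simps)
      ultimately show "- (a \<bullet> i) \<le> x \<bullet> i \<and> x \<bullet> i \<le> a \<bullet> i"
        using x i by force
    qed
  qed (rule integrable_continuous[OF c] | simp)+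
  ultimately show ?thesis using \<mu> by (simp add: divide_right_mono)
qed

lemma matrix_entry_le:
  fixes D :: "real ^ 'm ^ 'm"
  assumes "\<And>h. norm (D *v h) \<le> l * norm h"
  shows "\<bar>D $ i $ j\<bar> \<le> l"
proof -
  have "\<bar>D $ i $ j\<bar> = \<bar>(D *v axis j 1) $ i\<bar>" by (simp add: matrix_vector_mul_component inner_axis)
  also have "\<dots> \<le> norm (D *v axis j 1)" by (rule component_le_norm_cart)
  also have "\<dots> \<le> l" using assms[of "axis j 1"] by simp
  finally show ?thesis .
qed

lemma norm_det_le:
  fixes M :: "complex ^ 'm ^ 'm"
  assumes "\<And>i j. norm (M $ i $ j) \<le> c"
  shows "norm (det M) \<le> fact CARD('m) * c ^ CARD('m)"
proof -
  have "norm (det M) \<le> (\<Sum>p | p permutes (UNIV :: 'm set). c ^ CARD('m))"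
    unfolding det_def
  proof (rule sum_norm_le)
    fix p assume "p \<in> {p. p permutes (UNIV :: 'm set)}"
    have "norm (of_int (sign p) * (\<Prod>i\<in>UNIV. M $ i $ p i)) = (\<Prod>i\<in>UNIV. norm (M $ i $ p i))"
      by (simp add: norm_mult prod_norm sign_def)
    also have "\<dots> \<le> (\<Prod>i\<in>(UNIV::'m set). c)" by (intro prod_mono) (auto simp: assms)
    finally show "norm (of_int (sign p) * (\<Prod>i\<in>UNIV. M $ i $ p i)) \<le> c ^ CARD('m)" by simp
  qed
  also have "\<dots> = fact CARD('m) * c ^ CARD('m)"
    by (simp add: card_permutations[OF refl])
  finally show ?thesis .
qed

text \<open>
  The kernel \<open>K\<close> integrates to \<open>c\<close>, so the difference is the integral of \<open>(f x - f x0) * K x\<close>,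
  where \<open>K\<close> decays like a Gaussian centred at \<open>x0\<close>.  The requirement on
  \<open>\<delta>\<close> says that the centre is missed by at most a multiple of the width of the Gaussian.
  Half of the decay is spent on the factor \<open>(norm (x - x0))\<^sup>2\<close>, which gains \<open>1 / k\<close>.
\<close>

lemma complex_gaussian_kernel_estimate:
  fixes A B :: "real ^ 'm::{finite,wellorder} \<Rightarrow> real ^ 'm::_" and f :: "real ^ 'm::_ \<Rightarrow> complex"
  assumes A: "\<And>x. (A has_derivative (\<lambda>h. DA x *v h)) (at x)" "continuous_on UNIV DA"
    and B: "\<And>x. (B has_derivative (\<lambda>h. DB x *v h)) (at x)" "continuous_on UNIV DB"
    and lip: "\<And>x y. norm (A x - A y) + norm (B x - B y) \<le> l * norm (x - y)"
    and l: "0 \<le> l" "l < 1"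
    and supp: "\<And>x. x \<notin> cbox (- a) a \<Longrightarrow> A x = 0" "\<And>x. x \<notin> cbox (- a) a \<Longrightarrow> B x = 0"
    and x0: "x0 \<in> cbox (- a) a" "norm (x0 + A x0) + norm (B x0) \<le> \<delta>"
    and k: "k > 0" "k * ((2 + 2 / (1 - l)) * \<delta>\<^sup>2) \<le> 1"
    and f: "continuous_on (cbox (- a) a) f"
      "\<And>x. x \<in> cbox (- a) a \<Longrightarrow> norm (f x - f x0) \<le> e + C * (norm (x - x0))\<^sup>2"
    and e: "0 \<le> e" "0 \<le> C"
  defines "K \<equiv> \<lambda>x. exp (- of_real k * (\<Sum>i\<in>UNIV. (Complex (x $ i + A x $ i) (B x $ i))\<^sup>2))
        * det (\<chi> i j. Complex ((mat 1 + DA x) $ i $ j) (DB x $ i $ j))"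
    and "c \<equiv> integral (cbox (- a) a) (\<lambda>x. exp (- k * (norm x)\<^sup>2))"
    and "\<mu> \<equiv> (1 - l) / 2"
  shows "norm (integral (cbox (- a) a) (\<lambda>x. f x * K x) - f x0 * of_real c)
     \<le> (exp 1 * (fact CARD('m) * 3 ^ CARD('m)) / \<mu> ^ CARD('m)) * (e + C / (k * \<mu>\<^sup>2)) * c"
proof -
  let ?S = "cbox (- a) a"
  define M where "M = fact CARD('m) * (3::real) ^ CARD('m)"
  have M: "M > 0" by (simp add: M_def)
  have \<mu>: "0 < \<mu>" "\<mu> \<le> 1 / 2" using l by (auto simp: \<mu>_def)
  have cA [continuous_intros]: "continuous_on S A" and cB [continuous_intros]: "continuous_on S B" for S
    using A(1) B(1) by (meson continuous_at_imp_continuous_on has_derivative_continuous)+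
  have cDA [continuous_intros]: "continuous_on S DA" and cDB [continuous_intros]: "continuous_on S DB" for S
    using A(2) B(2) continuous_on_subset by blast+
  have cK: "continuous_on ?S K"
    unfolding K_def det_def Complex_eq by (intro continuous_intros)
  have intK: "integral ?S K = of_real c"
    unfolding K_def c_def by (rule integral_gaussian_complex_perturbation[OF A B lip l supp])
  have lipA: "norm (A y - A x) \<le> l * norm (y - x)" and lipB: "norm (B y - B x) \<le> l * norm (y - x)" for x y
    using lip[of y x] norm_ge_zero[of "A y - A x"] norm_ge_zero[of "B y - B x"] by linarith+
  have det: "norm (det (\<chi> i j. Complex ((mat 1 + DA x) $ i $ j) (DB x $ i $ j))) \<le> M" for x
    unfolding M_def
  proof (rule norm_det_le, simp only: vec_lambda_beta)
    fix i j
    have "norm (Complex ((mat 1 + DA x) $ i $ j) (DB x $ i $ j)) \<le> \<bar>(mat 1 + DA x) $ i $ j\<bar> + \<bar>DB x $ i $ j\<bar>"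
      using cmod_le[of "Complex ((mat 1 + DA x) $ i $ j) (DB x $ i $ j)"] by simp
    also have "\<dots> \<le> (\<bar>(mat 1 :: real ^ 'm::_ ^ 'm::_) $ i $ j\<bar> + \<bar>DA x $ i $ j\<bar>) + \<bar>DB x $ i $ j\<bar>"
      using abs_triangle_ineq[of "(mat 1 :: real ^ 'm::_ ^ 'm::_) $ i $ j"] by simp
    also have "\<dots> \<le> (1 + 1) + 1"
      using matrix_entry_le[OF lipschitz_derivative_bound[OF A(1) lipA], of x i j]
        matrix_entry_le[OF lipschitz_derivative_bound[OF B(1) lipB], of x i j] l
      by (intro add_mono) (auto simp: mat_def)
    finally show "norm (Complex ((mat 1 + DA x) $ i $ j) (DB x $ i $ j)) \<le> 3" by simp
  qed
  have K: "norm (K x) \<le> M * exp (1 - 2 * (k * (\<mu>\<^sup>2 * (norm (x - x0))\<^sup>2)))" for x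
  proof -
    let ?X = "x + A x" and ?t = "norm (x - x0)"
    have tri: "?t - norm (A x - A x0) - norm (x0 + A x0) \<le> norm ?X"
      using norm_triangle_ineq2[of "x - x0" "- (A x - A x0) - (x0 + A x0)"]
        norm_triangle_ineq4[of "- (A x - A x0)" "x0 + A x0"] norm_minus_commute[of "A x0" "A x"]
      by (simp add: algebra_simps)
    have tri2: "norm ?X \<le> ?t + norm (A x - A x0) + norm (x0 + A x0)"
      using norm_triangle_le[of "x - x0 + (A x - A x0)" "x0 + A x0" "?t + norm (A x - A x0) + norm (x0 + A x0)"]
        norm_triangle_ineq[of "x - x0" "A x - A x0"] by (simp add: algebra_simps)
    have tri3: "norm (B x) \<le> norm (B x - B x0) + norm (B x0)"
      using norm_triangle_ineq[of "B x - B x0" "B x0"] by simp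
    have l1: "norm (A x - A x0) + norm (B x - B x0) \<le> 1 * ?t"
      by (rule order_trans[OF lip]) (use l in \<open>intro mult_right_mono; simp\<close>)
    have "(1 - l)\<^sup>2 / 2 * ?t\<^sup>2 - (2 + 2 / (1 - l)) * \<delta>\<^sup>2 \<le> (norm ?X)\<^sup>2 - (norm (B x))\<^sup>2"
      using tri tri2 tri3 l1 lip[of x x0] x0(2)
      by (intro square_diff_lower_bound l) (auto simp: algebra_simps)
    then have "k * ((1 - l)\<^sup>2 / 2 * ?t\<^sup>2) - k * ((2 + 2 / (1 - l)) * \<delta>\<^sup>2) \<le> k * ((norm ?X)\<^sup>2 - (norm (B x))\<^sup>2)"
      using k(1) by (subst right_diff_distrib[symmetric]) (intro mult_left_mono, auto)
    moreover have "(1 - l)\<^sup>2 / 2 * ?t\<^sup>2 = 2 * (\<mu>\<^sup>2 * ?t\<^sup>2)"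
      by (simp add: \<mu>_def power_divide)
    ultimately have "k * (2 * (\<mu>\<^sup>2 * ?t\<^sup>2)) - k * ((2 + 2 / (1 - l)) * \<delta>\<^sup>2)
        \<le> k * ((norm ?X)\<^sup>2 - (norm (B x))\<^sup>2)"
      by (simp only:)
    moreover have "k * (2 * (\<mu>\<^sup>2 * ?t\<^sup>2)) = 2 * (k * (\<mu>\<^sup>2 * ?t\<^sup>2))" by simp
    ultimately have le: "- k * ((norm ?X)\<^sup>2 - (norm (B x))\<^sup>2) \<le> 1 - 2 * (k * (\<mu>\<^sup>2 * ?t\<^sup>2))"
      unfolding mult_minus_left using k(2) by linarith
    have "Re (- of_real k * (\<Sum>i\<in>UNIV. (Complex (x $ i + A x $ i) (B x $ i))\<^sup>2))
        = - k * ((norm ?X)\<^sup>2 - (norm (B x))\<^sup>2)"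
      using Re_sum_squares[of ?X "B x"] by simp
    then have "norm (K x) = exp (- k * ((norm ?X)\<^sup>2 - (norm (B x))\<^sup>2))
        * norm (det (\<chi> i j. Complex ((mat 1 + DA x) $ i $ j) (DB x $ i $ j)))"
      unfolding K_def by (simp only: norm_mult norm_exp_eq_Re)
    also have "\<dots> \<le> exp (1 - 2 * (k * (\<mu>\<^sup>2 * ?t\<^sup>2))) * M"
      using le det by (intro mult_mono) auto
    finally show ?thesis by (simp add: mult.commute)
  qed
  have i1: "(\<lambda>x. f x * K x) integrable_on ?S" and i2: "(\<lambda>x. f x0 * K x) integrable_on ?S"
    by (intro integrable_continuous continuous_intros f cK)+
  let ?g = "\<lambda>x. exp (- k * (\<mu>\<^sup>2 * (norm (x - x0))\<^sup>2))"
  let ?D = "exp 1 * M * (e + C / (k * \<mu>\<^sup>2))"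
  have "integral ?S (\<lambda>x. f x * K x) - f x0 * of_real c = integral ?S (\<lambda>x. f x * K x - f x0 * K x)"
    unfolding integral_diff[OF i1 i2] integral_mult_right intK ..
  also have "norm \<dots> \<le> integral ?S (\<lambda>x. ?D * ?g x)"
  proof (rule integral_norm_bound_integral)
    show "(\<lambda>x. f x * K x - f x0 * K x) integrable_on ?S" using i1 i2 by (rule integrable_diff)
    show "(\<lambda>x. ?D * ?g x) integrable_on ?S"
      by (intro integrable_continuous continuous_intros)
    fix x assume x: "x \<in> ?S"
    define s where "s = k * (\<mu>\<^sup>2 * (norm (x - x0))\<^sup>2)"
    have s: "0 \<le> s" using k by (simp add: s_def)
    have "norm (f x * K x - f x0 * K x) = norm (f x - f x0) * norm (K x)"
      by (simp add: left_diff_distrib[symmetric] norm_mult)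
    also have "\<dots> \<le> (e + C * (norm (x - x0))\<^sup>2) * (M * exp (1 - 2 * s))"
      using f(2)[OF x] K[of x] e M unfolding s_def by (intro mult_mono) auto
    also have "C * (norm (x - x0))\<^sup>2 = C / (k * \<mu>\<^sup>2) * s"
      using k \<mu> by (simp add: s_def)
    also have "(e + C / (k * \<mu>\<^sup>2) * s) * (M * exp (1 - 2 * s))
        = exp 1 * M * ((e + C / (k * \<mu>\<^sup>2) * s) * (exp (- s) * exp (- s)))"
      by (simp add: exp_add[symmetric] mult_ac)
    also have "\<dots> \<le> exp 1 * M * ((e + C / (k * \<mu>\<^sup>2)) * exp (- s))"
    proof (rule mult_left_mono)
      have "s \<le> exp s" using exp_ge_add_one_self[of s] by linarith
      then have "s * exp (- s) \<le> 1" by (simp add: exp_minus field_simps)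
      moreover have "e * exp (- s) \<le> e" using e s by (simp add: mult_left_le)
      moreover have "C / (k * \<mu>\<^sup>2) * (s * exp (- s)) \<le> C / (k * \<mu>\<^sup>2) * 1"
        using e k \<mu> \<open>s * exp (- s) \<le> 1\<close> by (intro mult_left_mono) auto
      ultimately have "(e + C / (k * \<mu>\<^sup>2) * s) * exp (- s) \<le> e + C / (k * \<mu>\<^sup>2)"
        unfolding distrib_right mult.assoc by linarith
      then show "(e + C / (k * \<mu>\<^sup>2) * s) * (exp (- s) * exp (- s)) \<le> (e + C / (k * \<mu>\<^sup>2)) * exp (- s)"
        unfolding mult.assoc[symmetric] by (rule mult_right_mono) simp
    qed (use M in simp)
    finally show "norm (f x * K x - f x0 * K x) \<le> ?D * ?g x"
      by (simp add: s_def mult_ac)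
  qed
  also have "\<dots> = ?D * integral ?S ?g" by simp
  also have "\<dots> \<le> ?D * ((1 / \<mu> ^ DIM(real ^ 'm::_)) * c)"
    unfolding c_def using e k \<mu> M
    by (intro mult_left_mono integral_scaled_gaussian_le x0) auto
  also have "\<dots> = (exp 1 * M / \<mu> ^ CARD('m)) * (e + C / (k * \<mu>\<^sup>2)) * c" by simp
  finally show ?thesis unfolding M_def .
qed


definition cutoff :: "real \<Rightarrow> 'a::real_normed_vector \<Rightarrow> real" where
  "cutoff L x = max 0 (min 1 (2 - norm x / L))"

lemma cutoff_eq_1: "L > 0 \<Longrightarrow> norm x \<le> L \<Longrightarrow> cutoff L x = 1"
  by (simp add: cutoff_def field_simps)

lemma cutoff_eq_0: "L > 0 \<Longrightarrow> 2 * L \<le> norm x \<Longrightarrow> cutoff L x = 0"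
  by (simp add: cutoff_def field_simps)

lemma cutoff_mult_lipschitz:
  assumes "L > 0" "norm (g y) \<le> b"
  shows "norm (cutoff L x *\<^sub>R g x - cutoff L y *\<^sub>R g y) \<le> norm (g x - g y) + b / L * norm (x - y)"
proof -
  have "cutoff L x *\<^sub>R g x - cutoff L y *\<^sub>R g y
      = cutoff L x *\<^sub>R (g x - g y) + (cutoff L x - cutoff L y) *\<^sub>R g y"
    by (simp add: algebra_simps)
  then have "norm (cutoff L x *\<^sub>R g x - cutoff L y *\<^sub>R g y)
      \<le> \<bar>cutoff L x\<bar> * norm (g x - g y) + \<bar>cutoff L x - cutoff L y\<bar> * norm (g y)"
    by (metis norm_scaleR norm_triangle_ineq)
  also have "\<dots> \<le> 1 * norm (g x - g y) + (norm (x - y) / L) * b"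
  proof (intro add_mono mult_mono)
    have "\<bar>cutoff L x - cutoff L y\<bar> \<le> \<bar>norm x / L - norm y / L\<bar>" by (simp add: cutoff_def)
    also have "\<dots> = \<bar>norm x - norm y\<bar> / L" using assms(1) by (simp add: diff_divide_distrib[symmetric])
    also have "\<dots> \<le> norm (x - y) / L"
      using assms(1) norm_triangle_ineq3 by (intro divide_right_mono) auto
    finally show "\<bar>cutoff L x - cutoff L y\<bar> \<le> norm (x - y) / L" .
  qed (use assms in \<open>auto simp: cutoff_def\<close>)
  finally show ?thesis by (simp add: mult.commute)
qed

lemma continuous_on_lipschitz:
  fixes g :: "'a::real_normed_vector \<Rightarrow> 'b::real_normed_vector"
  assumes "\<And>x y. x \<in> S \<Longrightarrow> y \<in> S \<Longrightarrow> norm (g x - g y) \<le> l * norm (x - y)" "0 \<le> l"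
  shows "continuous_on S g"
  using assms by (intro lipschitz_on_continuous_on[of l] lipschitz_onI) (auto simp: dist_norm)

text \<open>
  The quadratic term is what a Gaussian average can absorb; in contrast to a case distinction between near and
  far points it gives a continuous majorant.
\<close>

lemma continuous_quadratic_modulus:
  fixes f :: "'a::euclidean_space \<Rightarrow> 'b::real_normed_vector"
  assumes "compact S" "continuous_on S f" "e > 0"
  shows "\<exists>C\<ge>0. \<forall>x\<in>S. \<forall>y\<in>S. norm (f x - f y) \<le> e + C * (norm (x - y))\<^sup>2"
proof -
  have "uniformly_continuous_on S f"
    using assms(1,2) by (rule compact_uniformly_continuous[rotated])
  then obtain \<rho> where \<rho>: "\<rho> > 0" "\<And>x y. x \<in> S \<Longrightarrow> y \<in> S \<Longrightarrow> norm (x - y) < \<rho> \<Longrightarrow> norm (f x - f y) < e"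
    using \<open>e > 0\<close> unfolding uniformly_continuous_on_def dist_norm by metis
  obtain F where F: "F > 0" "\<And>x. x \<in> S \<Longrightarrow> norm (f x) \<le> F"
    using compact_imp_bounded[OF compact_continuous_image[OF assms(2,1)]] by (auto simp: bounded_pos)
  have "norm (f x - f y) \<le> e + (2 * F / \<rho>\<^sup>2) * (norm (x - y))\<^sup>2" if xy: "x \<in> S" "y \<in> S" for x y
  proof (cases "norm (x - y) < \<rho>")
    case True
    have "0 \<le> (2 * F / \<rho>\<^sup>2) * (norm (x - y))\<^sup>2" using F by simp
    then show ?thesis using \<rho>(2)[OF xy True] by linarith
  next
    case False
    have "norm (f x - f y) \<le> 2 * F" using F(2)[OF xy(1)] F(2)[OF xy(2)] norm_triangle_ineq4[of "f x" "f y"] by linarith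
    also have "\<dots> = (2 * F / \<rho>\<^sup>2) * \<rho>\<^sup>2" using \<rho>(1) by simp
    also have "\<dots> \<le> (2 * F / \<rho>\<^sup>2) * (norm (x - y))\<^sup>2"
      using False F \<rho>(1) by (intro mult_left_mono power_mono) auto
    finally show ?thesis using \<open>e > 0\<close> by linarith
  qed
  then show ?thesis using F by (intro exI[of _ "2 * F / \<rho>\<^sup>2"]) auto
qed

lemma poly_approximable_compose:
  assumes "poly_approximable (\<Phi> ` E) (\<lambda>P. P) h"
  shows "poly_approximable E \<Phi> (\<lambda>x. h (\<Phi> x))"
  using assms unfolding poly_approximable_def by simp

section \<open>Density of polynomials on perturbations of real space\<close>

text \<open>
  Precomposition with the nearest point projection onto the convex set \<open>E\<close> extends \<open>A\<close>, \<open>B\<close> and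
  \<open>f\<close> to the whole space and keeps the constant \<open>l\<close>; then \<open>f\<close> is the limit of its Gaussian averages.
  The maps fed to the Gaussian identity, \<open>A1 X\<close> and \<open>B1 Y\<close>, depend on the point \<open>x0\<close> at which the average is
  evaluated, whereas the weight and the kernel of the average may not.  On the ball of radius
  \<open>L - 1\<close> the smoothed cutoff is \<open>1\<close> and the two differ by the constants \<open>X\<close> and \<open>Y\<close> only; outside that ball the
  extension of \<open>f\<close> is made to vanish.
\<close>

theorem poly_approximable_small_lipschitz_perturbation:
  fixes A B :: "real ^ 'm::{finite,wellorder} \<Rightarrow> real ^ 'm::_"
  assumes E: "compact E" "convex E" "E \<noteq> {}"
    and lip: "\<And>x y. x \<in> E \<Longrightarrow> y \<in> E \<Longrightarrow> norm (A x - A y) + norm (B x - B y) \<le> l * norm (x - y)"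
    and l: "0 \<le> l" "l < 1"
    and f: "continuous_on E f"
  shows "poly_approximable E (perturb A B) f"
proof -
  define \<pi> where "\<pi> = closest_point E"
  have \<pi>: "\<pi> x \<in> E" for x
    unfolding \<pi>_def using E by (intro closest_point_in_set compact_imp_closed)
  have \<pi>_self: "\<pi> x = x" if "x \<in> E" for x
    unfolding \<pi>_def using that by (rule closest_point_self)
  have \<pi>_lip: "norm (\<pi> x - \<pi> y) \<le> norm (x - y)" for x y
    unfolding \<pi>_def using closest_point_lipschitz[OF E(2) compact_imp_closed[OF E(1)] E(3), of x y]
    by (simp add: dist_norm)
  define A0 where "A0 x = A (\<pi> x)" for x
  define B0 where "B0 x = B (\<pi> x)" for x
  have lip0: "norm (A0 x - A0 y) + norm (B0 x - B0 y) \<le> l * norm (x - y)" for x y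
  proof -
    have "norm (A0 x - A0 y) + norm (B0 x - B0 y) \<le> l * norm (\<pi> x - \<pi> y)"
      unfolding A0_def B0_def by (rule lip[OF \<pi> \<pi>])
    also have "\<dots> \<le> l * norm (x - y)" using \<pi>_lip l by (intro mult_left_mono)
    finally show ?thesis .
  qed
  have lipAB: "norm (A x - A y) \<le> l * norm (x - y)" "norm (B x - B y) \<le> l * norm (x - y)"
    if "x \<in> E" "y \<in> E" for x y
    using lip[OF that] norm_ge_zero[of "A x - A y"] norm_ge_zero[of "B x - B y"] by linarith+
  have cAB: "continuous_on E A" "continuous_on E B"
    by (rule continuous_on_lipschitz[OF lipAB(1) l(1)], assumption+)
       (rule continuous_on_lipschitz[OF lipAB(2) l(1)], assumption+)
  obtain r where r: "r > 0" "\<And>x. x \<in> E \<Longrightarrow> norm x \<le> r"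
    using compact_imp_bounded[OF E(1)] by (auto simp: bounded_pos)
  obtain b1 where b1: "b1 > 0" "\<And>x. x \<in> E \<Longrightarrow> norm (A x) \<le> b1"
    using compact_imp_bounded[OF compact_continuous_image[OF cAB(1) E(1)]] by (auto simp: bounded_pos)
  obtain b2 where b2: "b2 > 0" "\<And>x. x \<in> E \<Longrightarrow> norm (B x) \<le> b2"
    using compact_imp_bounded[OF compact_continuous_image[OF cAB(2) E(1)]] by (auto simp: bounded_pos)
  define b where "b = (2 * b1 + r) + 2 * b2"
  \<comment> \<open>So large that the gradient of the cutoff raises the Lipschitz constant from \<open>l\<close> at most to the
    midpoint of \<open>l\<close> and \<open>1\<close>.\<close>
  define L where "L = r + 2 + 2 * b / (1 - l)"
  have L: "L \<ge> r + 2" "L > 0" "b / L \<le> (1 - l) / 2"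
  proof -
    have bpos: "b > 0" using b1 b2 r by (simp add: b_def)
    show "L \<ge> r + 2" using bpos l by (simp add: L_def)
    then show "L > 0" using r(1) by linarith
    have "2 * b / (1 - l) \<le> L" using r(1) by (simp add: L_def)
    then show "b / L \<le> (1 - l) / 2" using l \<open>L > 0\<close> by (simp add: field_simps)
  qed
  define l' where "l' = (1 + l) / 2"
  have l': "0 \<le> l'" "l' < 1" using l by (auto simp: l'_def)

  \<comment> \<open>Cut off, and translated so that the perturbation sends a point \<open>x0\<close> of \<open>E\<close> with
    \<open>x0 + A x0 = X\<close> and \<open>B x0 = Y\<close> to the origin.\<close>
  define A1 where "A1 X x = cutoff L x *\<^sub>R (A0 x - X)" for X x
  define B1 where "B1 Y x = cutoff L x *\<^sub>R (B0 x - Y)" for Y x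
  have lip1: "norm (A1 X x - A1 X y) + norm (B1 Y x - B1 Y y) \<le> l' * norm (x - y)"
    if X: "norm X \<le> r + b1" and Y: "norm Y \<le> b2" for X Y x y
  proof -
    have "norm (A0 y - X) \<le> 2 * b1 + r"
      using norm_triangle_ineq4[of "A0 y" X] b1(2)[OF \<pi>, of y] X unfolding A0_def by linarith
    from cutoff_mult_lipschitz[where g = "\<lambda>x. A0 x - X", OF L(2) this, of x]
    have 1: "norm (A1 X x - A1 X y) \<le> norm (A0 x - A0 y) + (2 * b1 + r) / L * norm (x - y)"
      by (simp add: A1_def)
    have "norm (B0 y - Y) \<le> 2 * b2"
      using norm_triangle_ineq4[of "B0 y" Y] b2(2)[OF \<pi>, of y] Y unfolding B0_def by linarith
    from cutoff_mult_lipschitz[where g = "\<lambda>x. B0 x - Y", OF L(2) this, of x]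
    have 2: "norm (B1 Y x - B1 Y y) \<le> norm (B0 x - B0 y) + (2 * b2) / L * norm (x - y)"
      by (simp add: B1_def)
    have "(2 * b1 + r) / L * norm (x - y) + (2 * b2) / L * norm (x - y) = b / L * norm (x - y)"
      by (simp add: b_def add_divide_distrib distrib_right)
    also have "\<dots> \<le> (1 - l) / 2 * norm (x - y)"
      using L(3) by (rule mult_right_mono) simp
    finally have "norm (A1 X x - A1 X y) + norm (B1 Y x - B1 Y y) \<le> l * norm (x - y) + (1 - l) / 2 * norm (x - y)"
      using 1 2 lip0[of x y] by linarith
    also have "\<dots> = l' * norm (x - y)" by (simp add: l'_def field_simps)
    finally show ?thesis .
  qed
  have c1: "continuous_on UNIV (A1 X)" "continuous_on UNIV (B1 Y)" if "norm X \<le> r + b1" "norm Y \<le> b2" for X Y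
  proof -
    have le: "norm (A1 X x - A1 X y) \<le> l' * norm (x - y)" "norm (B1 Y x - B1 Y y) \<le> l' * norm (x - y)" for x y
      using lip1[OF that, of x y] norm_ge_zero[of "A1 X x - A1 X y"] norm_ge_zero[of "B1 Y x - B1 Y y"]
      by linarith+
    show "continuous_on UNIV (A1 X)" "continuous_on UNIV (B1 Y)"
      by (rule continuous_on_lipschitz[OF le(1) l'(1)], rule continuous_on_lipschitz[OF le(2) l'(1)])
  qed
  have supp1: "A1 X x = 0" "B1 Y x = 0" if "2 * L \<le> norm x" for X Y x
    using cutoff_eq_0[OF L(2) that] by (auto simp: A1_def B1_def)
  have zero: "norm (0 :: real ^ 'm::_) \<le> r + b1" "norm (0 :: real ^ 'm::_) \<le> b2" using r(1) b1(1) b2(1) by auto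

  define a :: "real ^ 'm::_" where "a = (\<chi> i. 2 * L + 1)"
  let ?S = "cbox (- a) a"
  have outside: "2 * L + 1 < norm x" if "x \<notin> ?S" for x
  proof -
    have "\<exists>i. 2 * L + 1 < \<bar>x $ i\<bar>"
    proof (rule ccontr)
      assume "\<nexists>i. 2 * L + 1 < \<bar>x $ i\<bar>"
      then have le: "\<bar>x $ i\<bar> \<le> 2 * L + 1" for i by (simp add: not_less)
      have "- (2 * L + 1) \<le> x $ i \<and> x $ i \<le> 2 * L + 1" for i
        using le[of i] by linarith
      then have "x \<in> ?S" unfolding mem_box_cart a_def by simp
      with that show False ..
    qed
    then obtain i where "2 * L + 1 < \<bar>x $ i\<bar>" ..
    then show ?thesis using component_le_norm_cart[of x i] by linarith
  qed
  have inside: "x \<in> ?S" if "norm x \<le> 2 * L + 1" for x using outside[of x] that by force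
  have "box (- a) a \<noteq> {}"
  proof -
    have "0 \<in> box (- a) a" using L(2) by (simp add: mem_box_cart a_def)
    then show ?thesis by blast
  qed
  then have cpos: "0 < integral ?S (\<lambda>x. exp (- k * (norm x)\<^sup>2))" for k by (rule integral_gaussian_pos)

  define f1 where "f1 x = of_real (max 0 (min 1 (r + 1 - norm x))) * f (\<pi> x)" for x
  have f1_E: "f1 x = f x" if "x \<in> E" for x using r(2)[OF that] \<pi>_self[OF that] by (simp add: f1_def)
  have f1_0: "f1 x = 0" if "\<not> norm x < L - 1" for x using that L(1) by (simp add: f1_def)
  have cf1: "continuous_on S f1" for S
    unfolding f1_def
    by (intro continuous_intros continuous_on_compose2[OF f]) (use \<pi> in
        \<open>auto simp: \<pi>_def intro!: continuous_on_closest_point E compact_imp_closed\<close>)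
  show ?thesis
  proof (rule poly_approximable_limit)
    fix e :: real assume e: "e > 0"
    define \<mu> where "\<mu> = (1 - l') / 2"
    have \<mu>: "\<mu> > 0" using l' by (simp add: \<mu>_def)
    define M where "M = exp 1 * (fact CARD('m) * 3 ^ CARD('m)) / \<mu> ^ CARD('m)"
    have M: "M > 0" using \<mu> by (simp add: M_def)
    define e1 where "e1 = e / (3 * M)"
    have e1: "e1 > 0" using e M by (simp add: e1_def)
    obtain C where C: "C \<ge> 0" "\<And>x y. x \<in> ?S \<Longrightarrow> y \<in> ?S \<Longrightarrow> norm (f1 x - f1 y) \<le> e1 + C * (norm (x - y))\<^sup>2"
      using continuous_quadratic_modulus[OF compact_cbox cf1 e1] by blast
    define k where "k = 1 + C / (\<mu>\<^sup>2 * e1)"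
    have k: "k > 0" "C / (k * \<mu>\<^sup>2) \<le> e1"
    proof -
      have "C / (\<mu>\<^sup>2 * e1) \<ge> 0" using C \<mu> e1 by simp
      then show "k > 0" by (simp add: k_def)
      have "C / (\<mu>\<^sup>2 * e1) \<le> k" by (simp add: k_def)
      then show "C / (k * \<mu>\<^sup>2) \<le> e1" using \<open>k > 0\<close> \<mu> e1 by (simp add: field_simps)
    qed
    define C0 where "C0 = 2 + 2 / (1 - l')"
    have C0: "C0 > 0" using l' by (simp add: C0_def add_pos_pos)
    \<comment> \<open>Smoothing at scale \<open>d\<close> moves the centre by at most \<open>l' * d\<close>; this must be below the width
      of the Gaussian.\<close>
    define d where "d = min 1 (1 / (k * C0))"
    have d: "d > 0" "d \<le> 1" "k * (C0 * (l' * d)\<^sup>2) \<le> 1"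
    proof -
      show d0: "d > 0" "d \<le> 1" using k(1) C0 by (auto simp: d_def)
      have "(l' * d)\<^sup>2 = (l' * d) * (l' * d)" by (simp add: power2_eq_square)
      also have "\<dots> \<le> (1 * d) * (1 * 1)" using l' d0 by (intro mult_mono) auto
      also have "\<dots> \<le> 1 / (k * C0)" by (simp add: d_def)
      finally have "(k * C0) * (l' * d)\<^sup>2 \<le> (k * C0) * (1 / (k * C0))"
        using k(1) C0 by (intro mult_left_mono) auto
      then show "k * (C0 * (l' * d)\<^sup>2) \<le> 1" using k(1) C0 by simp
    qed
    have near: "norm (x - d *\<^sub>R y) \<le> norm x + 1" "norm x - 1 \<le> norm (x - d *\<^sub>R y)"
      if "norm y \<le> 1" for x y :: "real ^ 'm::_"
    proof -
      have "norm (d *\<^sub>R y) \<le> 1 * 1" using d that unfolding norm_scaleR by (intro mult_mono) auto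
      then show "norm (x - d *\<^sub>R y) \<le> norm x + 1" "norm x - 1 \<le> norm (x - d *\<^sub>R y)"
        using norm_triangle_ineq4[of x "d *\<^sub>R y"] norm_triangle_ineq2[of x "d *\<^sub>R y"] by linarith+
    qed
    have supp1': "x \<notin> ?S \<Longrightarrow> A1 X x = 0" "x \<notin> ?S \<Longrightarrow> B1 Y x = 0" for X Y x
      using supp1 outside[of x] by force+
    have supp2: "mollify d (A1 X) x = 0" "mollify d (B1 Y) x = 0" if "x \<notin> ?S" for X Y x
    proof -
      have "2 * L \<le> norm (x - d *\<^sub>R y)" if "norm y \<le> 1" for y
        using near(2)[OF that, of x] outside[OF \<open>x \<notin> ?S\<close>] by linarith
      then have "mollify d (A1 X) x = mollify d (\<lambda>_. 0) x" "mollify d (B1 Y) x = mollify d (\<lambda>_. 0) x"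
        using supp1 by (auto intro!: mollify_cong)
      then show "mollify d (A1 X) x = 0" "mollify d (B1 Y) x = 0" by (simp_all add: mollify_const)
    qed
    define At where "At = mollify d (A1 0)"
    define Bt where "Bt = mollify d (B1 0)"
    obtain DA where DA: "continuous_on UNIV DA" "\<And>x. (At has_derivative (\<lambda>h. DA x *v h)) (at x)"
      using mollify_C1[OF c1(1)[OF zero] supp1'(1) d(1)] unfolding At_def by blast
    obtain DB where DB: "continuous_on UNIV DB" "\<And>x. (Bt has_derivative (\<lambda>h. DB x *v h)) (at x)"
      using mollify_C1[OF c1(2)[OF zero] supp1'(2) d(1)] unfolding Bt_def by blast
    have cAt: "continuous_on S At" "continuous_on S Bt" for S
      using DA(2) DB(2) by (meson continuous_at_imp_continuous_on has_derivative_continuous)+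
    have cD: "continuous_on S DA" "continuous_on S DB" for S
      using DA(1) DB(1) continuous_on_subset by blast+
    define c where "c = integral ?S (\<lambda>x. exp (- k * (norm x)\<^sup>2))"
    have cp: "c > 0" unfolding c_def by (rule cpos)
    define w where "w x = (1 / of_real c) * (f1 x * det (\<chi> i j. Complex ((mat 1 + DA x) $ i $ j) (DB x $ i $ j)))" for x
    define g where "g P = integral ?S (\<lambda>x. w x * exp (of_real (- k) * (\<Sum>i\<in>UNIV. (P $ i - perturb At Bt x $ i)\<^sup>2)))" for P
    have cw: "continuous_on ?S w"
      unfolding w_def det_def Complex_eq by (intro continuous_intros cf1 cD)
    have cP: "continuous_on S (perturb A' B')" if "continuous_on S A'" "continuous_on S B'" for S and A' B' :: "real ^ 'm::_ \<Rightarrow> real ^ 'm::_"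
      unfolding perturb_def Complex_eq by (intro continuous_intros that)
    have "bounded (perturb A B ` E)"
      by (intro compact_imp_bounded compact_continuous_image cP cAB E)
    then have "poly_approximable (perturb A B ` E) (\<lambda>P. P) g"
      unfolding g_def by (intro poly_approximable_gaussian_integral cw cP cAt)
    then have approx: "poly_approximable E (perturb A B) (\<lambda>x. g (perturb A B x))"
      by (rule poly_approximable_compose)
    have "norm (g (perturb A B x0) - f x0) < e" if x0: "x0 \<in> E" for x0
    proof -
      define X where "X = x0 + A x0"
      define Y where "Y = B x0"
      have X: "norm X \<le> r + b1" and Y: "norm Y \<le> b2"
        using r(2)[OF x0] b1(2)[OF x0] b2(2)[OF x0] norm_triangle_ineq[of x0 "A x0"] by (auto simp: X_def Y_def)
      have x0S: "x0 \<in> ?S" using r(2)[OF x0] L(1) r(1) by (intro inside) linarith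
      obtain DA' where DA': "continuous_on UNIV DA'" "\<And>x. (mollify d (A1 X) has_derivative (\<lambda>h. DA' x *v h)) (at x)"
        using mollify_C1[OF c1(1)[OF X Y] supp1'(1) d(1)] by blast
      obtain DB' where DB': "continuous_on UNIV DB'" "\<And>x. (mollify d (B1 Y) has_derivative (\<lambda>h. DB' x *v h)) (at x)"
        using mollify_C1[OF c1(2)[OF X Y] supp1'(2) d(1)] by blast
      have lip2: "norm (mollify d (A1 X) x - mollify d (A1 X) y) + norm (mollify d (B1 Y) x - mollify d (B1 Y) y) \<le> l' * norm (x - y)" for x y
      proof (rule norm_mollify_diff_add_le[OF c1(1)[OF X Y] c1(1)[OF X Y] c1(2)[OF X Y] c1(2)[OF X Y]])
        fix z :: "real ^ 'm::_"
        show "norm (A1 X (x - d *\<^sub>R z) - A1 X (y - d *\<^sub>R z)) + norm (B1 Y (x - d *\<^sub>R z) - B1 Y (y - d *\<^sub>R z)) \<le> l' * norm (x - y)"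
          using lip1[OF X Y, of "x - d *\<^sub>R z" "y - d *\<^sub>R z"] by simp
      qed
      have base: "A1 X x0 = - x0" "B1 Y x0 = 0"
        using cutoff_eq_1[OF L(2), of x0] r(2)[OF x0] L(1) r(1) \<pi>_self[OF x0]
        by (auto simp: A1_def B1_def A0_def B0_def X_def Y_def)
      have "norm (mollify d (A1 X) x0 - mollify d (\<lambda>_. A1 X x0) x0) + norm (mollify d (B1 Y) x0 - mollify d (\<lambda>_. B1 Y x0) x0) \<le> l' * d"
      proof (rule norm_mollify_diff_add_le[OF c1(1)[OF X Y] continuous_on_const c1(2)[OF X Y] continuous_on_const])
        fix z :: "real ^ 'm::_" assume z: "norm z \<le> 1"
        have "norm (A1 X (x0 - d *\<^sub>R z) - A1 X x0) + norm (B1 Y (x0 - d *\<^sub>R z) - B1 Y x0) \<le> l' * (d * norm z)"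
          using lip1[OF X Y, of "x0 - d *\<^sub>R z" x0] d(1) by simp
        also have "\<dots> \<le> l' * (d * 1)" using z d l' by (intro mult_left_mono) auto
        finally show "norm (A1 X (x0 - d *\<^sub>R z) - A1 X x0) + norm (B1 Y (x0 - d *\<^sub>R z) - B1 Y x0) \<le> l' * d" by simp
      qed
      then have at_x0: "norm (x0 + mollify d (A1 X) x0) + norm (mollify d (B1 Y) x0) \<le> l' * d"
        by (simp add: mollify_const base add.commute)
      have shift: "mollify d (A1 X) x = At x - X" "mollify d (B1 Y) x = Bt x - Y" if "norm x < L - 1" for x
      proof -
        have "cutoff L (x - d *\<^sub>R y) = 1" if "norm y \<le> 1" for y
          using near(1)[OF that, of x] \<open>norm x < L - 1\<close> by (intro cutoff_eq_1 L) linarith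
        then have "mollify d (A1 X) x = mollify d (\<lambda>x. A1 0 x - X) x" "mollify d (B1 Y) x = mollify d (\<lambda>x. B1 0 x - Y) x"
          by (auto intro!: mollify_cong simp: A1_def B1_def)
        then show "mollify d (A1 X) x = At x - X" "mollify d (B1 Y) x = Bt x - Y"
          unfolding At_def Bt_def by (simp_all add: mollify_diff_const[OF c1(1)[OF zero]] mollify_diff_const[OF c1(2)[OF zero]])
      qed
      have same: "DA' x = DA x" "DB' x = DB x" if x: "norm x < L - 1" for x
      proof -
        have x': "x \<in> ball 0 (L - 1)" using x by simp
        have "((\<lambda>x. At x - X) has_derivative (\<lambda>h. DA x *v h)) (at x)"
          using has_derivative_diff[OF DA(2) has_derivative_const] by simp
        then have "(mollify d (A1 X) has_derivative (\<lambda>h. DA x *v h)) (at x)"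
          by (rule has_derivative_transform_within_open[OF _ open_ball x']) (simp add: shift)
        from has_derivative_unique[OF this DA'(2)] show "DA' x = DA x" by (simp add: matrix_eq fun_eq_iff)
        have "((\<lambda>x. Bt x - Y) has_derivative (\<lambda>h. DB x *v h)) (at x)"
          using has_derivative_diff[OF DB(2) has_derivative_const] by simp
        then have "(mollify d (B1 Y) has_derivative (\<lambda>h. DB x *v h)) (at x)"
          by (rule has_derivative_transform_within_open[OF _ open_ball x']) (simp add: shift)
        from has_derivative_unique[OF this DB'(2)] show "DB' x = DB x" by (simp add: matrix_eq fun_eq_iff)
      qed
      define K where "K x = exp (- of_real k * (\<Sum>i\<in>UNIV. (Complex (x $ i + mollify d (A1 X) x $ i) (mollify d (B1 Y) x $ i))\<^sup>2))
        * det (\<chi> i j. Complex ((mat 1 + DA' x) $ i $ j) (DB' x $ i $ j))" for x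
      have "norm (integral ?S (\<lambda>x. f1 x * K x) - f1 x0 * of_real c) \<le> M * (e1 + C / (k * \<mu>\<^sup>2)) * c"
        unfolding K_def M_def \<mu>_def c_def
        by (rule complex_gaussian_kernel_estimate[OF DA'(2,1) DB'(2,1) lip2 l' supp2 x0S at_x0 k(1) _ cf1 C(2)[OF _ x0S] less_imp_le[OF e1] C(1)])
           (use d(3) in \<open>simp_all add: C0_def\<close>)
      also have "\<dots> \<le> M * (e1 + e1) * c"
        using k(2) M cp by (intro mult_right_mono mult_left_mono) auto
      finally have est: "norm (integral ?S (\<lambda>x. f1 x * K x) - f1 x0 * of_real c) \<le> M * (e1 + e1) * c" .
      have "w x * exp (of_real (- k) * (\<Sum>i\<in>UNIV. (perturb A B x0 $ i - perturb At Bt x $ i)\<^sup>2))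
          = (1 / of_real c) * (f1 x * K x)" for x
      proof (cases "norm x < L - 1")
        case True
        have "(perturb A B x0 $ i - perturb At Bt x $ i)\<^sup>2
            = (Complex (x $ i + mollify d (A1 X) x $ i) (mollify d (B1 Y) x $ i))\<^sup>2" for i
        proof -
          have "Complex (x $ i + mollify d (A1 X) x $ i) (mollify d (B1 Y) x $ i) = - (perturb A B x0 $ i - perturb At Bt x $ i)"
            unfolding shift[OF True] unfolding perturb_def X_def Y_def by (simp add: complex_eq_iff)
          then show ?thesis by (simp only: power2_minus)
        qed
        then show ?thesis unfolding w_def K_def same[OF True] by simp
      next
        case False
        then show ?thesis using f1_0[of x] by (simp add: w_def)
      qed
      then have "g (perturb A B x0) = (1 / of_real c) * integral ?S (\<lambda>x. f1 x * K x)"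
        unfolding g_def by (simp only: integral_mult_right)
      then have "g (perturb A B x0) - f x0 = (integral ?S (\<lambda>x. f1 x * K x) - f1 x0 * of_real c) / of_real c"
        using cp f1_E[OF x0] by (simp add: diff_divide_distrib)
      then have "norm (g (perturb A B x0) - f x0) = norm (integral ?S (\<lambda>x. f1 x * K x) - f1 x0 * of_real c) / c"
        using cp by (simp only: norm_divide norm_of_real abs_of_pos)
      also have "\<dots> \<le> (M * (e1 + e1) * c) / c"
        by (rule divide_right_mono[OF est]) (use cp in simp)
      also have "\<dots> = 2 * e / 3" using cp M by (simp add: e1_def)
      also have "\<dots> < e" using e by simp
      finally show ?thesis .
    qed
    then show "\<exists>g. poly_approximable E (perturb A B) g \<and> (\<forall>x\<in>E. norm (g x - f x) < e)"
      using approx by blast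
  qed
qed

section \<open>Density of polynomials on perturbed graphs of conjugation\<close>

lemma sum_over_sum_type:
  fixes g :: "'a::finite + 'b::finite \<Rightarrow> 'c::comm_monoid_add"
  shows "(\<Sum>s\<in>UNIV. g s) = (\<Sum>i\<in>UNIV. g (Inl i)) + (\<Sum>j\<in>UNIV. g (Inr j))"
  using sum.Plus[of UNIV UNIV g] by (simp add: o_def)

lemma norm_vec_power2: "(norm (v :: 'a::real_normed_vector ^ 'n))\<^sup>2 = (\<Sum>i\<in>UNIV. (norm (v $ i))\<^sup>2)"
  by (simp add: norm_vec_def L2_set_def sum_nonneg)

lemma norm_vec_eq:
  assumes "\<And>i. norm ((v :: 'a::real_normed_vector ^ 'n) $ i) = norm ((v' :: 'b::real_normed_vector ^ 'n) $ i)"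
  shows "norm v = norm v'"
  by (simp add: norm_vec_def L2_set_def assms)

text \<open>
  Polynomials in polynomials are polynomials: approximation transfers along a polynomial map.
\<close>

lemma poly_approximable_polynomial_image:
  assumes "poly_approximable K \<Phi> f" and "\<And>i. complex_polynomial (g i)"
    and "\<And>x. x \<in> K \<Longrightarrow> \<Phi> x = (\<chi> i. g i (\<Psi> x))"
  shows "poly_approximable K \<Psi> f"
  unfolding poly_approximable_def
proof (intro allI impI)
  fix e :: real assume "e > 0"
  then obtain p where p: "complex_polynomial p" "\<forall>x\<in>K. cmod (p (\<Phi> x) - f x) < e"
    using assms(1) unfolding poly_approximable_def by blast
  then have "\<forall>x\<in>K. cmod (p (\<chi> i. g i (\<Psi> x)) - f x) < e" using assms(3) by simp
  with complex_polynomial_compose[OF p(1) assms(2)]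
  show "\<exists>p. complex_polynomial p \<and> (\<forall>x\<in>K. cmod (p (\<Psi> x) - f x) < e)"
    by (intro exI[of _ "\<lambda>Z. p (\<chi> i. g i Z)"]) simp
qed

text \<open>
  The change of variables formula needs a well-ordered index type; \<open>'n bit0\<close> is one with
  twice as many elements as \<open>'n\<close>, and \<open>e\<close> matches its elements with real and imaginary parts.
\<close>

definition real_coords ::
    "('n bit0 \<Rightarrow> 'n::finite + 'n) \<Rightarrow> complex ^ 'n \<Rightarrow> real ^ 'n bit0" where
  "real_coords e w = (\<chi> k. case e k of Inl j \<Rightarrow> Re (w $ j) | Inr j \<Rightarrow> Im (w $ j))"

definition complex_coords ::
    "('n bit0 \<Rightarrow> 'n::finite + 'n) \<Rightarrow> real ^ 'n bit0 \<Rightarrow> complex ^ 'n" where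
  "complex_coords e x = (\<chi> j. Complex (x $ inv e (Inl j)) (x $ inv e (Inr j)))"

lemma complex_coords_real_coords:
  assumes e: "bij e"
  shows "complex_coords e (real_coords e w) = w"
  using bij_is_surj[OF e] by (simp add: complex_coords_def real_coords_def vec_eq_iff surj_f_inv_f)

lemma linear_real_coords: "linear (real_coords e)"
  by (rule linearI) (auto simp: real_coords_def vec_eq_iff split: sum.split)

lemma norm_real_coords:
  assumes e: "bij e"
  shows "norm (real_coords e w) = norm w"
proof -
  have "(norm (real_coords e w))\<^sup>2 = (\<Sum>k\<in>UNIV. (case e k of Inl j \<Rightarrow> Re (w $ j) | Inr j \<Rightarrow> Im (w $ j))\<^sup>2)"
    by (simp add: norm_vec_power2 real_coords_def)
  also have "\<dots> = (\<Sum>s\<in>UNIV. (case s of Inl j \<Rightarrow> Re (w $ j) | Inr j \<Rightarrow> Im (w $ j))\<^sup>2)"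
    by (rule sum.reindex_bij_betw[OF e])
  also have "\<dots> = (\<Sum>j\<in>UNIV. (Re (w $ j))\<^sup>2 + (Im (w $ j))\<^sup>2)"
    by (simp add: sum_over_sum_type sum.distrib)
  also have "\<dots> = (norm w)\<^sup>2" by (simp add: norm_vec_power2 cmod_power2)
  finally show ?thesis by simp
qed

text \<open>
  In real coordinates put \<open>\<zeta> = x + G / 2\<close> and \<open>\<omega> = y + \<i> G / 2\<close> for \<open>w = x + \<i> y\<close>.  These
  are polynomials in \<open>w\<close> and \<open>cnj w + G w\<close>, and they displace \<open>(x, y)\<close> by a real and an
  imaginary part whose Lipschitz constants are \<open>c / 2\<close> each.
\<close>

theorem poly_approximable_contraction_of_conjugate:
  fixes E :: "(complex ^ 'n) set" and G :: "complex ^ 'n \<Rightarrow> complex ^ 'n"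
  assumes E: "compact E" "convex E" "E \<noteq> {}"
    and lip: "\<And>w w'. w \<in> E \<Longrightarrow> w' \<in> E \<Longrightarrow> norm (G w - G w') \<le> c * norm (w - w')"
    and c: "0 \<le> c" "c < 1"
    and f: "continuous_on E f"
  shows "poly_approximable E (\<lambda>w. join_vec w (\<chi> j. cnj (w $ j) + G w $ j)) f"
proof -
  have "card (UNIV :: 'n bit0 set) = card (UNIV :: ('n + 'n) set)"
    using card_Plus[of "UNIV :: 'n set" "UNIV :: 'n set"] by simp
  then obtain e :: "'n bit0 \<Rightarrow> 'n + 'n" where e: "bij e"
    using finite_same_card_bij[of "UNIV :: 'n bit0 set" "UNIV :: ('n + 'n) set"] by auto
  note defs = real_coords_def[of e] complex_coords_def[of e]
  let ?r = "real_coords e" and ?z = "complex_coords e"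
  note zr = complex_coords_real_coords[OF e] and lin = linear_real_coords[of e] and nr = norm_real_coords[OF e]
  have rdiff: "norm (?r v - ?r v') = norm (v - v')" for v v'
    using nr[of "v - v'"] linear_diff[OF lin] by simp
  define A where "A x = ?r (\<chi> j. cnj (G (?z x) $ j) / 2)" for x
  define B where "B x = ?r (\<chi> j. \<i> * cnj (G (?z x) $ j) / 2)" for x
  have half: "norm ((\<chi> j. u * cnj (v $ j) / 2) - (\<chi> j. u * cnj (v' $ j) / 2)) = norm (v - v') / 2"
    if "cmod u = 1" for u and v v' :: "complex ^ 'n"
  proof -
    have "norm ((\<chi> j. u * cnj (v $ j) / 2) - (\<chi> j. u * cnj (v' $ j) / 2)) = norm ((1/2) *\<^sub>R (v - v'))"
    proof (rule norm_vec_eq)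
      fix i
      have "u * cnj (v $ i) / 2 - u * cnj (v' $ i) / 2 = u * cnj (v $ i - v' $ i) / 2"
        by (simp add: algebra_simps diff_divide_distrib)
      then have "cmod (u * cnj (v $ i) / 2 - u * cnj (v' $ i) / 2) = cmod (v $ i - v' $ i) / 2"
        by (simp only: norm_mult norm_divide complex_mod_cnj that norm_numeral mult_1)
      then show "norm (((\<chi> j. u * cnj (v $ j) / 2) - (\<chi> j. u * cnj (v' $ j) / 2)) $ i) = norm (((1/2) *\<^sub>R (v - v')) $ i)"
        by simp
    qed
    then show ?thesis by simp
  qed
  have E': "compact (?r ` E)" "convex (?r ` E)" "?r ` E \<noteq> {}"
    using E lin compact_continuous_image[OF linear_continuous_on[OF lin[unfolded linear_conv_bounded_linear]] E(1)]
    by (auto intro: convex_linear_image)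
  have "poly_approximable (?r ` E) (perturb A B) (\<lambda>x. f (?z x))"
  proof (rule poly_approximable_small_lipschitz_perturbation[OF E' _ c])
    fix x y assume "x \<in> ?r ` E" "y \<in> ?r ` E"
    then obtain v w where x: "x = ?r v" "v \<in> E" and y: "y = ?r w" "w \<in> E" by blast
    have "norm (A x - A y) = norm (G v - G w) / 2" "norm (B x - B y) = norm (G v - G w) / 2"
      using half[of 1 "G v" "G w"] half[of \<i> "G v" "G w"] by (simp_all add: A_def B_def x y zr rdiff)
    then show "norm (A x - A y) + norm (B x - B y) \<le> c * norm (x - y)"
      using lip[OF x(2) y(2)] by (simp add: x y rdiff)
  next
    have "continuous_on (?r ` E) ?z"
      unfolding defs(2) Complex_eq by (intro continuous_intros)
    then show "continuous_on (?r ` E) (\<lambda>x. f (?z x))"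
      by (rule continuous_on_compose2[OF f]) (auto simp: zr)
  qed
  then have approx: "poly_approximable E (\<lambda>w. perturb A B (?r w)) f"
    unfolding poly_approximable_def by (simp add: zr)
  define g where "g k Z = (case e k of Inl j \<Rightarrow> (1/2) * (Z $ Inl j + Z $ Inr j)
      | Inr j \<Rightarrow> (- \<i> / 2) * (Z $ Inl j + (- 1) * Z $ Inr j))" for k and Z :: "complex ^ ('n + 'n)"
  show ?thesis
  proof (rule poly_approximable_polynomial_image[OF approx, of g])
    show "complex_polynomial (g k)" for k
    proof (cases "e k")
      case (Inl j)
      have "complex_polynomial (\<lambda>Z :: complex ^ ('n + 'n). (1/2) * (Z $ Inl j + Z $ Inr j))"
        by (intro complex_polynomial_mult complex_polynomial_add
            complex_polynomial_const complex_polynomial_coord)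
      then show ?thesis unfolding g_def Inl by simp
    next
      case (Inr j)
      have "complex_polynomial (\<lambda>Z :: complex ^ ('n + 'n). (- \<i> / 2) * (Z $ Inl j + (- 1) * Z $ Inr j))"
        by (intro complex_polynomial_mult complex_polynomial_add
            complex_polynomial_const complex_polynomial_coord)
      then show ?thesis unfolding g_def Inr by simp
    qed
    fix w assume "w \<in> E"
    show "perturb A B (?r w) = (\<chi> k. g k (join_vec w (\<chi> j. cnj (w $ j) + G w $ j)))"
      unfolding perturb_def A_def B_def zr unfolding defs(1) g_def join_vec_def
      by (auto simp: vec_eq_iff complex_eq_iff algebra_simps split: sum.split)
  qed
qed

section \<open>Polydiscs, power maps and functions on the graph\<close>

definition closed_polydisc :: "('n \<Rightarrow> real) \<Rightarrow> (complex ^ 'n) set" where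
  "closed_polydisc r = {z. \<forall>j. cmod (z $ j) \<le> r j}"

lemma compact_closed_polydisc: "compact (closed_polydisc r :: (complex ^ 'n) set)"
  unfolding compact_eq_bounded_closed
proof
  have "norm z \<le> (\<Sum>j\<in>UNIV. r j)" if "z \<in> closed_polydisc r" for z :: "complex ^ 'n"
  proof -
    have "norm z \<le> (\<Sum>j\<in>UNIV. norm (z $ j))" unfolding norm_vec_def by (rule L2_set_le_sum) simp
    also have "\<dots> \<le> (\<Sum>j\<in>UNIV. r j)" using that by (intro sum_mono) (simp add: closed_polydisc_def)
    finally show ?thesis .
  qed
  then show "bounded (closed_polydisc r :: (complex ^ 'n) set)" unfolding bounded_iff by blast
  have "closed_polydisc r = (\<Inter>j. {z :: complex ^ 'n. cmod (z $ j) \<le> r j})"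
    by (auto simp: closed_polydisc_def)
  also have "closed \<dots>" by (intro closed_INT ballI closed_Collect_le continuous_intros)
  finally show "closed (closed_polydisc r :: (complex ^ 'n) set)" .
qed

lemma convex_closed_polydisc: "convex (closed_polydisc r)"
proof -
  have "closed_polydisc r = (\<Inter>j. (\<lambda>z. z $ j) -` cball 0 (r j))"
    by (auto simp: closed_polydisc_def)
  also have "convex \<dots>"
    by (intro convex_INT convex_linear_vimage bounded_linear.linear bounded_linear_vec_nth convex_cball)
  finally show ?thesis .
qed

lemma closure_open_polydisc:
  fixes r :: "'n::finite \<Rightarrow> real"
  assumes "\<And>j. 0 < r j"
  shows "closure (open_polydisc 0 r :: (complex ^ 'n) set) = closed_polydisc r"
proof
  show "closure (open_polydisc 0 r) \<subseteq> closed_polydisc r"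
    by (rule closure_minimal)
       (auto simp: open_polydisc_def closed_polydisc_def less_imp_le
         intro!: compact_imp_closed[OF compact_closed_polydisc[unfolded closed_polydisc_def]])
  show "closed_polydisc r \<subseteq> closure (open_polydisc 0 r)"
  proof
    fix z :: "complex ^ 'n" assume z: "z \<in> closed_polydisc r"
    define u where "u n = (1 - 1 / real (n + 2)) *\<^sub>R z" for n
    have "u n \<in> open_polydisc 0 r" for n
    proof -
      define t where "t = 1 - 1 / real (n + 2)"
      have t: "0 \<le> t" "t < 1" by (auto simp: t_def)
      have "t * cmod (z $ j) < r j" for j
      proof (cases "z $ j = 0")
        case False
        then have "t * cmod (z $ j) < 1 * cmod (z $ j)" using t by (intro mult_strict_right_mono) auto
        also have "\<dots> \<le> r j" using z by (simp add: closed_polydisc_def)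
        finally show ?thesis .
      qed (simp add: assms)
      moreover have "u n = t *\<^sub>R z" by (simp only: u_def t_def)
      ultimately show ?thesis using t by (simp add: open_polydisc_def)
    qed
    moreover have "u \<longlonglongrightarrow> (1 - 0) *\<^sub>R z"
      unfolding u_def
      by (intro tendsto_intros LIMSEQ_ignore_initial_segment[OF lim_1_over_n])
    ultimately show "z \<in> closure (open_polydisc 0 r)"
      unfolding closure_sequential by (intro exI[of _ u]) simp
  qed
qed

definition coord_powers :: "('n \<Rightarrow> nat) \<Rightarrow> complex ^ 'n \<Rightarrow> complex ^ 'n" where
  "coord_powers m z = (\<chi> j. (z $ j) ^ m j)"

lemma coord_powers_closed_polydisc:
  assumes m: "\<And>j. 1 \<le> m j" and r: "\<And>j. 0 < r j"
  shows "coord_powers m ` closed_polydisc r = closed_polydisc (\<lambda>j. r j ^ m j)"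
proof
  show "coord_powers m ` closed_polydisc r \<subseteq> closed_polydisc (\<lambda>j. r j ^ m j)"
    by (auto simp: closed_polydisc_def coord_powers_def norm_power intro!: power_mono)
  show "closed_polydisc (\<lambda>j. r j ^ m j) \<subseteq> coord_powers m ` closed_polydisc r"
  proof
    fix w assume w: "w \<in> closed_polydisc (\<lambda>j. r j ^ m j)"
    have "\<exists>\<zeta>. \<zeta> ^ m j = w $ j" for j
      using exists_complex_root[of "m j" "w $ j"] m[of j] by (metis not_one_le_zero)
    then obtain \<zeta> where \<zeta>: "\<And>j. \<zeta> j ^ m j = w $ j" by metis
    have "cmod (\<zeta> j) \<le> r j" for j
    proof (rule power_le_imp_le_base)
      have "cmod (\<zeta> j) ^ m j \<le> r j ^ m j"
        using w \<zeta>[of j] by (simp add: closed_polydisc_def norm_power[symmetric])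
      then show "cmod (\<zeta> j) ^ Suc (m j - 1) \<le> r j ^ Suc (m j - 1)" using m[of j] by simp
    qed (use r[of j] in simp)
    then have "(\<chi> j. \<zeta> j) \<in> closed_polydisc r" by (simp add: closed_polydisc_def)
    moreover have "w = coord_powers m (\<chi> j. \<zeta> j)" by (simp add: coord_powers_def vec_eq_iff \<zeta>)
    ultimately show "w \<in> coord_powers m ` closed_polydisc r" by blast
  qed
qed

lemma continuous_on_coord_powers: "continuous_on S (coord_powers m)"
  unfolding coord_powers_def by (intro continuous_intros)

text \<open>
  With \<open>t = |z|\<^sup>2\<close> and \<open>s = t + \<epsilon>\<^sup>2\<close> the difference is \<open>cnj z * ((t / s)^q - 1)\<close>.  Bernoulli's inequality
  bounds the second factor by \<open>q \<epsilon>\<^sup>2 / s\<close>, and \<open>|z| \<epsilon> \<le> s\<close>.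
\<close>

lemma conjugate_regularization_error:
  fixes z :: complex
  assumes "\<epsilon> > 0"
  shows "cmod (z ^ q * cnj z ^ Suc q * of_real (1 / ((cmod z)\<^sup>2 + \<epsilon>\<^sup>2) ^ q) - cnj z) \<le> real q * \<epsilon>"
proof -
  define t where "t = (cmod z)\<^sup>2"
  define s where "s = t + \<epsilon>\<^sup>2"
  have t: "0 \<le> t" by (simp add: t_def)
  have s: "s > 0" using t assms by (simp add: s_def add_nonneg_pos)
  have x: "0 \<le> \<epsilon>\<^sup>2 / s" "\<epsilon>\<^sup>2 / s \<le> 1" using s t by (auto simp: s_def)
  have ts: "t / s = 1 - \<epsilon>\<^sup>2 / s" using s by (simp add: s_def field_simps)
  have "z * cnj z = of_real t" by (simp only: t_def complex_norm_square)
  then have "z ^ q * cnj z ^ q = of_real (t ^ q)"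
    by (simp only: power_mult_distrib[symmetric] of_real_power)
  then have "z ^ q * cnj z ^ Suc q * of_real (1 / s ^ q) - cnj z = cnj z * of_real ((t / s) ^ q - 1)"
    by (simp add: power_divide algebra_simps)
  then have "cmod (z ^ q * cnj z ^ Suc q * of_real (1 / s ^ q) - cnj z) = cmod z * \<bar>(t / s) ^ q - 1\<bar>"
    by (simp only: norm_mult complex_mod_cnj norm_of_real)
  also have "\<bar>(t / s) ^ q - 1\<bar> \<le> real q * (\<epsilon>\<^sup>2 / s)"
  proof -
    have "1 + real q * (- (\<epsilon>\<^sup>2 / s)) \<le> (1 + (- (\<epsilon>\<^sup>2 / s))) ^ q"
      by (rule Bernoulli_inequality) (use x in simp)
    moreover have "(t / s) ^ q \<le> 1" unfolding ts using x by (intro power_le_one) auto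
    ultimately show ?thesis by (simp add: ts)
  qed
  then have "cmod z * \<bar>(t / s) ^ q - 1\<bar> \<le> cmod z * (real q * (\<epsilon>\<^sup>2 / s))"
    by (rule mult_left_mono) simp
  also have "\<dots> = real q * (cmod z * \<epsilon> / s) * \<epsilon>" by (simp add: power2_eq_square)
  also have "\<dots> \<le> real q * 1 * \<epsilon>"
  proof (intro mult_right_mono mult_left_mono)
    have "2 * (cmod z * \<epsilon>) \<le> s"
      using sum_squares_bound[of "cmod z" \<epsilon>] by (simp add: s_def t_def mult.assoc)
    moreover have "0 \<le> cmod z * \<epsilon>" using assms by simp
    ultimately show "cmod z * \<epsilon> / s \<le> 1" using s by simp
  qed (use assms in auto)
  finally show ?thesis by (simp add: s_def t_def)
qed

text \<open>
  Points with the same powers have the same value of \<open>R\<close>, so \<open>R\<close> descends to a contraction \<open>G\<close>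
  on the image polydisc; any choice of roots computes it.
\<close>

lemma graph_fibre_functions_approximable:
  fixes R F :: "complex ^ 'n \<Rightarrow> complex ^ 'n"
  assumes r: "\<And>j. 0 < r j" and m: "\<And>j. 1 \<le> m j" and c: "0 \<le> c" "c < 1"
    and F: "\<And>z j. z \<in> closed_polydisc r \<Longrightarrow> F z $ j = cnj (z $ j) ^ m j + R z $ j"
    and lip: "\<And>z \<xi>. z \<in> closed_polydisc r \<Longrightarrow> \<xi> \<in> closed_polydisc r \<Longrightarrow>
      norm (R z - R \<xi>) \<le> c * norm (coord_powers m z - coord_powers m \<xi>)"
    and h: "continuous_on (closed_polydisc (\<lambda>j. r j ^ m j)) h"
  shows "poly_approximable (closed_polydisc r) (\<lambda>z. join_vec z (F z)) (\<lambda>z. h (coord_powers m z))"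
proof -
  let ?K = "closed_polydisc r" and ?E = "closed_polydisc (\<lambda>j. r j ^ m j)" and ?w = "coord_powers m"
  define G where "G w = R (inv_into ?K ?w w)" for w
  have img: "?w ` ?K = ?E" by (rule coord_powers_closed_polydisc[OF m r])
  have root: "inv_into ?K ?w w \<in> ?K" "?w (inv_into ?K ?w w) = w" if "w \<in> ?E" for w
    using that inv_into_into[of w ?w ?K] f_inv_into_f[of w ?w ?K] by (simp_all add: img)
  have G: "G (?w z) = R z" if "z \<in> ?K" for z
  proof -
    have wz: "?w z \<in> ?E" using that img by blast
    have "norm (G (?w z) - R z) \<le> 0"
      using lip[OF root(1)[OF wz] that] by (simp add: G_def root(2)[OF wz])
    then show ?thesis by simp
  qed
  have "0 \<in> ?E" using r by (simp add: closed_polydisc_def less_imp_le)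
  then have ne: "?E \<noteq> {}" by blast
  have "poly_approximable ?E (\<lambda>w. join_vec w (\<chi> j. cnj (w $ j) + G w $ j)) h"
  proof (rule poly_approximable_contraction_of_conjugate[OF compact_closed_polydisc convex_closed_polydisc ne _ c h])
    fix w w' assume "w \<in> ?E" "w' \<in> ?E"
    then show "norm (G w - G w') \<le> c * norm (w - w')"
      using lip[of "inv_into ?K ?w w" "inv_into ?K ?w w'"] root by (simp add: G_def)
  qed
  then have approx: "poly_approximable ?K (\<lambda>z. join_vec (?w z) (\<chi> j. cnj (?w z $ j) + G (?w z) $ j)) (\<lambda>z. h (?w z))"
    unfolding poly_approximable_def img[symmetric] by simp
  define g where "g k Z = (case k of Inl j \<Rightarrow> (Z $ Inl j) ^ m j | Inr j \<Rightarrow> Z $ Inr j)"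
    for k and Z :: "complex ^ ('n + 'n)"
  show ?thesis
  proof (rule poly_approximable_polynomial_image[OF approx, of g])
    show "complex_polynomial (g k)" for k
      unfolding g_def
      by (cases k) (auto intro!: complex_polynomial_power complex_polynomial_coord)
    show "join_vec (?w z) (\<chi> j. cnj (?w z $ j) + G (?w z) $ j) = (\<chi> k. g k (join_vec z (F z)))"
      if "z \<in> ?K" for z
      using F[OF that] G[OF that]
      by (auto simp: vec_eq_iff join_vec_def g_def coord_powers_def split: sum.split)
  qed
qed

text \<open>
  All continuous functions of the powers are available.  Division by \<open>z\<^sub>j^(m\<^sub>j - 1)\<close> is impossible at the
  origin, so conjugates are reached through regularised quotients; real and imaginary parts of the
  coordinates then separate points.
\<close>

theorem graph_polynomials_dense:
  fixes R F :: "complex ^ 'n \<Rightarrow> complex ^ 'n"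
  assumes r: "\<And>j. 0 < r j" and m: "\<And>j. 1 \<le> m j" and c: "0 \<le> c" "c < 1"
    and F: "\<And>z j. z \<in> closed_polydisc r \<Longrightarrow> F z $ j = cnj (z $ j) ^ m j + R z $ j"
    and lip: "\<And>z \<xi>. z \<in> closed_polydisc r \<Longrightarrow> \<xi> \<in> closed_polydisc r \<Longrightarrow>
      norm (R z - R \<xi>) \<le> c * norm (coord_powers m z - coord_powers m \<xi>)"
    and h: "continuous_on (closed_polydisc r) h"
  shows "poly_approximable (closed_polydisc r) (\<lambda>z. join_vec z (F z)) h"
proof -
  let ?K = "closed_polydisc r" and ?w = "coord_powers m"
  let ?A = "poly_approximable ?K (\<lambda>z. join_vec z (F z))"
  have bdd: "bounded (u ` ?K)" if "continuous_on ?K u" for u :: "complex ^ 'n \<Rightarrow> complex"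
    using compact_imp_bounded[OF compact_continuous_image[OF that compact_closed_polydisc]] .
  have const: "?A (\<lambda>_. u)" for u
    using poly_approximable_polynomial[OF complex_polynomial_const] by blast
  have coord: "?A (\<lambda>z. z $ j)" for j
  proof -
    have "?A (\<lambda>z. join_vec z (F z) $ Inl j)"
      by (rule poly_approximable_polynomial[OF complex_polynomial_coord])
    then show ?thesis by (simp add: join_vec_def)
  qed
  have coord_power: "?A (\<lambda>z. (z $ j) ^ q)" for j q
  proof -
    have "?A (\<lambda>z. (join_vec z (F z) $ Inl j) ^ q)"
      by (rule poly_approximable_polynomial[OF complex_polynomial_power[OF complex_polynomial_coord]])
    then show ?thesis by (simp add: join_vec_def)
  qed
  have cnj: "?A (\<lambda>z. cnj (z $ j))" for j
  proof (rule poly_approximable_limit)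
    fix e :: real assume "e > 0"
    define q where "q = m j - 1"
    have mj: "m j = Suc q" using m[of j] by (simp add: q_def)
    define \<epsilon> where "\<epsilon> = e / (real q + 1)"
    have \<epsilon>: "\<epsilon> > 0" "real q * \<epsilon> < e"
      using \<open>e > 0\<close> by (simp_all add: \<epsilon>_def field_simps add_pos_nonneg)
    \<comment> \<open>The modulus of \<open>z $ j\<close> is the root of the modulus of its power, so this is a function of the powers alone.\<close>
    define u where "u w = cnj (w $ j) * of_real (1 / ((root (m j) (cmod (w $ j)))\<^sup>2 + \<epsilon>\<^sup>2) ^ q)" for w :: "complex ^ 'n"
    have pos: "x\<^sup>2 + \<epsilon>\<^sup>2 \<noteq> 0" for x using \<epsilon>(1) by (simp add: sum_power2_eq_zero_iff)
    have cu: "continuous_on S u" for S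
      unfolding u_def by (intro continuous_intros) (use pos in auto)
    have u: "u (?w z) = cnj (z $ j) ^ Suc q * of_real (1 / ((cmod (z $ j))\<^sup>2 + \<epsilon>\<^sup>2) ^ q)" for z
      using m[of j] by (simp add: u_def coord_powers_def norm_power real_root_power_cancel mj del: power_Suc)
    have "?A (\<lambda>z. u (?w z))"
      by (rule graph_fibre_functions_approximable[OF r m c F lip cu])
    then have "?A (\<lambda>z. (z $ j) ^ q * u (?w z))"
      by (intro poly_approximable_mult coord_power bdd continuous_intros
          continuous_on_compose2[OF cu[of UNIV] continuous_on_coord_powers]) auto
    moreover have "cmod ((z $ j) ^ q * u (?w z) - cnj (z $ j)) < e" for z
      using conjugate_regularization_error[OF \<epsilon>(1), of "z $ j" q] \<epsilon>(2) unfolding u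
      by (simp only: mult.assoc)
    ultimately show "\<exists>g. ?A g \<and> (\<forall>z\<in>?K. cmod (g z - cnj (z $ j)) < e)" by blast
  qed
  define P where "P g \<longleftrightarrow> continuous_on ?K g \<and> ?A (\<lambda>z. complex_of_real (g z))" for g
  have Re: "P (\<lambda>z. Re (z $ j))" and Im: "P (\<lambda>z. Im (z $ j))" for j
  proof -
    have "?A (\<lambda>z. (1/2) * (z $ j + cnj (z $ j)))" "?A (\<lambda>z. (- \<i> / 2) * (z $ j + (- 1) * cnj (z $ j)))"
      by (intro poly_approximable_mult poly_approximable_add const coord cnj bdd continuous_intros)+
    moreover have "(1/2) * (z + cnj z) = of_real (Re z)" "(- \<i> / 2) * (z + (- 1) * cnj z) = of_real (Im z)" for z
      by (simp_all add: complex_eq_iff)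
    ultimately show "P (\<lambda>z. Re (z $ j))" "P (\<lambda>z. Im (z $ j))"
      by (simp_all add: P_def continuous_intros)
  qed
  have dense: "\<exists>g. P g \<and> (\<forall>z\<in>?K. \<bar>f z - g z\<bar> < e)" if f: "continuous_on ?K f" and e: "e > 0" for f e
  proof (rule Stone_Weierstrass_HOL[OF compact_closed_polydisc _ _ _ _ _ f e, of P])
    show "P (\<lambda>x. u)" for u by (simp add: P_def const continuous_on_const)
    show "continuous_on ?K g" if "P g" for g using that by (simp add: P_def)
    show "P (\<lambda>x. g x + g' x)" if "P g \<and> P g'" for g g'
      using that by (auto simp: P_def intro!: continuous_intros poly_approximable_add)
    show "P (\<lambda>x. g x * g' x)" if "P g \<and> P g'" for g g'
      using that by (auto simp: P_def intro!: continuous_intros poly_approximable_mult bdd)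
    show "\<exists>g. P g \<and> g x \<noteq> g y" if xy: "x \<in> ?K \<and> y \<in> ?K \<and> x \<noteq> y" for x y
    proof -
      obtain j where "x $ j \<noteq> y $ j" using xy by (auto simp: vec_eq_iff)
      then have "Re (x $ j) \<noteq> Re (y $ j) \<or> Im (x $ j) \<noteq> Im (y $ j)" by (simp add: complex_eq_iff)
      then show ?thesis using Re[of j] Im[of j] by blast
    qed
  qed
  have real: "?A (\<lambda>z. complex_of_real (f z))" if f: "continuous_on ?K f" for f
  proof (rule poly_approximable_limit)
    fix e :: real assume "e > 0"
    then obtain g where "P g" "\<forall>z\<in>?K. \<bar>f z - g z\<bar> < e" using dense[OF f] by blast
    then show "\<exists>g. ?A g \<and> (\<forall>z\<in>?K. cmod (g z - complex_of_real (f z)) < e)"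
      by (intro exI[of _ "\<lambda>z. complex_of_real (g z)"])
         (auto simp: P_def of_real_diff[symmetric] abs_minus_commute simp del: of_real_diff)
  qed
  have "?A (\<lambda>z. complex_of_real (Re (h z)) + \<i> * complex_of_real (Im (h z)))"
    by (intro poly_approximable_add poly_approximable_mult const real bdd continuous_intros h)
  then show ?thesis by (simp add: complex_eq[symmetric])
qed

section \<open>Polynomial convexity and the uniform algebra\<close>

lemma complex_polynomial_exp_Taylor:
  assumes "complex_polynomial q"
  shows "complex_polynomial (\<lambda>z. \<Sum>k\<le>n. q z ^ k / fact k)"
proof -
  have "complex_polynomial (\<lambda>z. \<Sum>k\<le>n. (1 / fact k) * q z ^ k)"
    by (intro complex_polynomial_sum complex_polynomial_mult complex_polynomial_const
        complex_polynomial_power assms)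
  then show ?thesis by simp
qed

lemma subset_polynomial_hull:
  assumes "compact X"
  shows "X \<subseteq> polynomial_hull X"
proof
  fix x assume x: "x \<in> X"
  have "cmod (p x) \<le> (SUP z\<in>X. cmod (p z))" if "complex_polynomial p" for p
  proof (rule cSUP_upper[OF x])
    have "compact ((\<lambda>z. cmod (p z)) ` X)"
      by (intro compact_continuous_image continuous_on_norm continuous_on_complex_polynomial that assms)
    then show "bdd_above ((\<lambda>z. cmod (p z)) ` X)" by (rule compact_imp_bounded[THEN bounded_imp_bdd_above])
  qed
  then show "x \<in> polynomial_hull X" by (simp add: polynomial_hull_def)
qed

lemma polynomial_hull_le:
  assumes "\<alpha> \<in> polynomial_hull X" "X \<noteq> {}" "complex_polynomial p" "\<And>x. x \<in> X \<Longrightarrow> cmod (p x) \<le> M"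
  shows "cmod (p \<alpha>) \<le> M"
proof -
  have "cmod (p \<alpha>) \<le> (SUP z\<in>X. cmod (p z))" using assms(1,3) by (simp add: polynomial_hull_def)
  also have "\<dots> \<le> M" using assms(2,4) by (rule cSUP_least)
  finally show ?thesis .
qed

text \<open>
  The functions \<open>exp (- k q) * g\<close> are limits of polynomials.  On \<open>X\<close> they are at most
  \<open>C s exp (- k \<kappa> s\<^sup>2)\<close>, which tends to \<open>0\<close> uniformly in \<open>s\<close>, but their value at \<open>\<alpha>\<close> is always \<open>g \<alpha>\<close>.
\<close>

lemma polynomial_hull_eq_0_of_peak:
  assumes \<alpha>: "\<alpha> \<in> polynomial_hull X" and X: "compact X"
    and q: "complex_polynomial q" "q \<alpha> = 0" and g: "complex_polynomial g"
    and le: "\<And>x. x \<in> X \<Longrightarrow> cmod (g x) \<le> C * s x" "\<And>x. x \<in> X \<Longrightarrow> \<kappa> * (s x)\<^sup>2 \<le> Re (q x)"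
    and pos: "\<kappa> > 0" "C > 0" "\<And>x. x \<in> X \<Longrightarrow> 0 \<le> s x" and ne: "X \<noteq> {}"
  shows "g \<alpha> = 0"
proof -
  have "cmod (g \<alpha>) \<le> 0 + \<eta>" if \<eta>: "\<eta> > 0" for \<eta>
  proof -
    define \<eta>' where "\<eta>' = \<eta> / (3 * C)"
    have \<eta>': "\<eta>' > 0" using \<eta> pos by (simp add: \<eta>'_def)
    \<comment> \<open>Chosen so that \<open>s \<le> \<eta>' (1 + t)\<close> for \<open>t = k \<kappa> s\<^sup>2\<close>, hence \<open>s exp (- t) \<le> \<eta>'\<close>.\<close>
    define k where "k = 1 / (\<eta>'\<^sup>2 * \<kappa>)"
    have k: "k > 0" using \<eta>' pos by (simp add: k_def)
    obtain B where B: "B > 0" "\<And>x. x \<in> X \<Longrightarrow> cmod (g x) \<le> B"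
      using compact_imp_bounded[OF compact_continuous_image[OF continuous_on_complex_polynomial[OF g] X]]
      by (auto simp: bounded_pos)
    have qk: "complex_polynomial (\<lambda>z. of_real (- k) * q z)"
      by (intro complex_polynomial_mult complex_polynomial_const q)
    obtain r where r: "\<And>x. x \<in> X \<Longrightarrow> cmod (of_real (- k) * q x) \<le> r"
      using compact_imp_bounded[OF compact_continuous_image[OF continuous_on_complex_polynomial[OF qk] X]]
      by (auto simp: bounded_iff)
    have "\<eta> / (3 * B) > 0" using \<eta> B by simp
    then obtain n where n: "\<And>z :: complex. norm z \<le> r \<Longrightarrow> norm ((\<Sum>k\<le>n. z ^ k / fact k) - exp z) < \<eta> / (3 * B)"
      using exp_Taylor_uniform by metis
    let ?T = "\<lambda>z. \<Sum>j\<le>n. (of_real (- k) * q z) ^ j / fact j"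
    have "cmod (?T \<alpha> * g \<alpha>) \<le> \<eta>"
    proof (rule polynomial_hull_le[OF \<alpha> ne, of "\<lambda>z. ?T z * g z"])
      show "complex_polynomial (\<lambda>z. ?T z * g z)"
        by (intro complex_polynomial_mult complex_polynomial_exp_Taylor qk g)
      fix x assume x: "x \<in> X"
      have "cmod (exp (of_real (- k) * q x)) * cmod (g x) \<le> exp (- (k * (\<kappa> * (s x)\<^sup>2))) * (C * s x)"
        using le[OF x] k pos(2,3) x by (intro mult_mono) auto
      also have "\<dots> \<le> C * (\<eta>' + \<eta>')"
      proof -
        define t where "t = k * (\<kappa> * (s x)\<^sup>2)"
        have t: "0 \<le> t" using k pos by (simp add: t_def)
        have "0 \<le> (s x - \<eta>')\<^sup>2" by simp
        then have "2 * \<eta>' * s x \<le> \<eta>'\<^sup>2 + (s x)\<^sup>2" by (simp add: power2_diff mult_ac)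
        moreover have "0 \<le> \<eta>' * s x" using \<eta>' pos(3)[OF x] by simp
        ultimately have "s x \<le> (\<eta>'\<^sup>2 + (s x)\<^sup>2) / \<eta>'"
          using \<eta>' by (simp add: field_simps)
        also have "\<dots> = \<eta>' * (1 + t)" using \<eta>' pos by (simp add: t_def k_def field_simps power2_eq_square)
        also have "\<dots> \<le> \<eta>' * exp t" using \<eta>' exp_ge_add_one_self[of t] by (intro mult_left_mono) auto
        finally have "exp (- t) * s x \<le> exp (- t) * (\<eta>' * exp t)" by (intro mult_left_mono) auto
        also have "\<dots> = \<eta>'" by (simp add: exp_minus)
        finally have "exp (- t) * s x \<le> \<eta>' + \<eta>'" using \<eta>' by simp
        then have "C * (exp (- t) * s x) \<le> C * (\<eta>' + \<eta>')" using pos(2) by (intro mult_left_mono) auto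
        then show ?thesis by (simp add: t_def mult_ac)
      qed
      also have "\<dots> = 2 * \<eta> / 3" using pos by (simp add: \<eta>'_def)
      finally have 1: "cmod (exp (of_real (- k) * q x)) * cmod (g x) \<le> 2 * \<eta> / 3" .
      have "cmod (?T x - exp (of_real (- k) * q x)) * cmod (g x) \<le> \<eta> / (3 * B) * B"
        using n[OF r[OF x]] B(2)[OF x] B(1) \<eta> by (intro mult_mono) auto
      also have "\<dots> = \<eta> / 3" using B by simp
      finally have 2: "cmod (?T x - exp (of_real (- k) * q x)) * cmod (g x) \<le> \<eta> / 3" .
      have "cmod (?T x) \<le> cmod (?T x - exp (of_real (- k) * q x)) + cmod (exp (of_real (- k) * q x))"
        by (metis diff_add_cancel norm_triangle_ineq)
      then have "cmod (?T x * g x) \<le> (cmod (?T x - exp (of_real (- k) * q x)) + cmod (exp (of_real (- k) * q x))) * cmod (g x)"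
        unfolding norm_mult by (rule mult_right_mono) simp
      also have "\<dots> \<le> \<eta> / 3 + 2 * \<eta> / 3" unfolding distrib_right using 1 2 by (rule add_mono[rotated])
      finally show "cmod (?T x * g x) \<le> \<eta>" by simp
    qed
    moreover have "?T \<alpha> = (\<Sum>j\<le>n. if j = 0 then 1 else 0)"
      by (rule sum.cong) (auto simp: q(2) power_0_left)
    then have "?T \<alpha> = 1" by (simp only: sum.delta finite_atMost) simp
    ultimately show ?thesis by simp
  qed
  then have "cmod (g \<alpha>) \<le> 0" by (rule field_le_epsilon)
  then show ?thesis by simp
qed

text \<open>
  The polynomial \<open>q\<close> vanishes at every point over \<open>a\<close>, on the graph or not, and on the graph its real part
  is at least \<open>(1 - c)\<close> times the squared distance of the powers of \<open>z\<close> and \<open>a\<close>.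
\<close>

theorem polynomially_convex_graph:
  fixes R F :: "complex ^ 'n \<Rightarrow> complex ^ 'n"
  assumes r: "\<And>j. 0 < r j" and c: "0 \<le> c" "c < 1"
    and F: "\<And>z j. z \<in> closed_polydisc r \<Longrightarrow> F z $ j = cnj (z $ j) ^ m j + R z $ j"
    and lip: "\<And>z \<xi>. z \<in> closed_polydisc r \<Longrightarrow> \<xi> \<in> closed_polydisc r \<Longrightarrow>
      norm (R z - R \<xi>) \<le> c * norm (coord_powers m z - coord_powers m \<xi>)"
    and cF: "continuous_on (closed_polydisc r) F"
  shows "polynomially_convex (graph_over (closed_polydisc r) F)"
proof -
  let ?K = "closed_polydisc r" and ?X = "graph_over (closed_polydisc r) F" and ?w = "coord_powers m"
  have comp: "compact ?X"
    unfolding graph_over_def join_vec_def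
  proof (intro compact_continuous_image continuous_on_vec_lambda compact_closed_polydisc)
    fix k :: "'n + 'n"
    show "continuous_on ?K (\<lambda>z. case k of Inl i \<Rightarrow> z $ i | Inr j \<Rightarrow> F z $ j)"
      by (cases k) (auto intro!: continuous_intros cF)
  qed
  have "0 \<in> ?K" using r by (simp add: closed_polydisc_def less_imp_le)
  then have ne: "?X \<noteq> {}" by (auto simp: graph_over_def)
  have "\<alpha> \<in> ?X" if \<alpha>: "\<alpha> \<in> polynomial_hull ?X" for \<alpha>
  proof -
    define a where "a = (\<chi> i. \<alpha> $ Inl i)"
    have "cmod (\<alpha> $ Inl i) \<le> r i" for i
      by (rule polynomial_hull_le[OF \<alpha> ne complex_polynomial_coord])
         (auto simp: graph_over_def join_vec_def closed_polydisc_def)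
    then have a: "a \<in> ?K" by (simp add: closed_polydisc_def a_def)
    define q where "q Z = (\<Sum>i\<in>UNIV. ((Z $ Inl i) ^ m i + (- ((a $ i) ^ m i))) * (Z $ Inr i + (- (F a $ i))))" for Z :: "complex ^ ('n + 'n)"
    have q: "complex_polynomial q"
      unfolding q_def
      by (intro complex_polynomial_sum complex_polynomial_mult complex_polynomial_add
          complex_polynomial_power complex_polynomial_coord complex_polynomial_const)
    have q0: "q \<alpha> = 0" by (simp add: q_def a_def)
    have key: "cmod (join_vec z (F z) $ Inr j + (- (F a $ j))) \<le> 2 * norm (?w z - ?w a)"
      "(1 - c) * (norm (?w z - ?w a))\<^sup>2 \<le> Re (q (join_vec z (F z)))" if z: "z \<in> ?K" for z j
    proof -
      let ?u = "?w z - ?w a" and ?g = "R z - R a"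
      have lz: "norm ?g \<le> c * norm ?u" using lip[OF z a] .
      have Fd: "F z $ i - F a $ i = cnj (?u $ i) + ?g $ i" for i
        by (simp add: F[OF z] F[OF a] coord_powers_def)
      have "cmod (F z $ j - F a $ j) \<le> cmod (?u $ j) + cmod (?g $ j)"
        unfolding Fd by (metis complex_mod_cnj norm_triangle_ineq)
      also have "\<dots> \<le> norm ?u + norm ?g" by (intro add_mono Finite_Cartesian_Product.norm_nth_le)
      also have "norm ?g \<le> 1 * norm ?u" using lz by (rule order_trans) (use c in \<open>intro mult_right_mono; simp\<close>)
      finally show "cmod (join_vec z (F z) $ Inr j + (- (F a $ j))) \<le> 2 * norm ?u"
        by (simp add: join_vec_def)
      have "q (join_vec z (F z)) = (\<Sum>i\<in>UNIV. ?u $ i * (cnj (?u $ i) + ?g $ i))"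
        unfolding q_def Fd[symmetric] by (simp add: join_vec_def coord_powers_def)
      then have "Re (q (join_vec z (F z))) = (\<Sum>i\<in>UNIV. (cmod (?u $ i))\<^sup>2) + (\<Sum>i\<in>UNIV. Re (?u $ i * ?g $ i))"
        by (simp add: distrib_left sum.distrib complex_norm_square[symmetric] del: minus_complex.sel vector_minus_component)
      moreover have "(\<Sum>i\<in>UNIV. (cmod (?u $ i))\<^sup>2) = (norm ?u)\<^sup>2" by (simp only: norm_vec_power2)
      moreover have "\<bar>\<Sum>i\<in>UNIV. Re (?u $ i * ?g $ i)\<bar> \<le> c * (norm ?u)\<^sup>2"
      proof -
        have "(\<Sum>i\<in>UNIV. Re (?u $ i * ?g $ i)) = ?u \<bullet> (\<chi> i. cnj (?g $ i))"
          by (simp add: inner_vec_def inner_complex_def algebra_simps)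
        moreover have "norm (\<chi> i. cnj (?g $ i)) = norm ?g"
          by (rule norm_vec_eq) (simp del: complex_cnj_diff)
        ultimately have "\<bar>\<Sum>i\<in>UNIV. Re (?u $ i * ?g $ i)\<bar> \<le> norm ?u * norm ?g"
          using Cauchy_Schwarz_ineq2[of ?u "\<chi> i. cnj (?g $ i)"] by simp
        also have "\<dots> \<le> norm ?u * (c * norm ?u)" using lz by (rule mult_left_mono) simp
        finally show ?thesis by (simp add: power2_eq_square mult_ac)
      qed
      ultimately show "(1 - c) * (norm ?u)\<^sup>2 \<le> Re (q (join_vec z (F z)))"
        by (simp add: left_diff_distrib)
    qed
    have "\<alpha> $ Inr j = F a $ j" for j
    proof -
      define s where "s Z = norm (?w (\<chi> i. Z $ Inl i) - ?w a)" for Z :: "complex ^ ('n + 'n)"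
      have s: "s (join_vec z (F z)) = norm (?w z - ?w a)" for z
        by (simp add: s_def join_vec_def)
      have "\<alpha> $ Inr j + (- (F a $ j)) = 0"
      proof (rule polynomial_hull_eq_0_of_peak[OF \<alpha> comp q q0, where \<kappa> = "1 - c" and C = 2 and s = s])
        show "complex_polynomial (\<lambda>Z. Z $ Inr j + (- (F a $ j)))"
          by (intro complex_polynomial_add complex_polynomial_coord complex_polynomial_const)
      qed (use key s c ne in \<open>auto simp: graph_over_def s_def\<close>)
      then show ?thesis by (simp add: eq_neg_iff_add_eq_0[symmetric])
    qed
    then have "\<alpha> = join_vec a (F a)"
      by (auto simp: vec_eq_iff join_vec_def a_def split: sum.split)
    then show ?thesis using a by (auto simp: graph_over_def)
  qed
  then show ?thesis
    unfolding polynomially_convex_def using comp subset_polynomial_hull[OF comp] by blast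
qed

lemma uniform_algebra_eq_continuous_functions:
  fixes f :: "'N::finite \<Rightarrow> 'a::t2_space \<Rightarrow> complex"
  assumes K: "compact K" "K \<noteq> {}"
    and cont: "\<And>k. continuous_on K (f k)"
    and dense: "\<And>h. continuous_on K h \<Longrightarrow> poly_approximable K (\<lambda>z. \<chi> k. f k z) h"
  shows "uniform_algebra f K = continuous_functions K"
proof -
  let ?m = "cfunspace (top_of_set K) (euclidean_metric :: complex metric)"
  let ?P = "{restrict (\<lambda>z. p (\<chi> k. f k z)) K | p. complex_polynomial p}"
  have M: "mspace ?m = continuous_functions K"
    using continuous_functions_eq_mspace[OF K(1)] by simp
  have P: "?P \<subseteq> mspace ?m"
  proof
    fix u assume "u \<in> ?P"
    then obtain p where p: "u = restrict (\<lambda>z. p (\<chi> k. f k z)) K" "complex_polynomial p" by blast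
    have "continuous_on K (\<lambda>z. p (\<chi> k. f k z))"
      by (rule continuous_on_compose2[OF continuous_on_complex_polynomial[OF p(2), of UNIV]])
         (auto intro!: continuous_on_vec_lambda cont)
    then show "u \<in> mspace ?m" unfolding M p(1) continuous_functions_def
      by (auto cong: continuous_on_cong)
  qed
  interpret Metric_space "mspace ?m" "mdist ?m" by (rule Metric_space_mspace_mdist)
  have "g \<in> mtopology_of ?m closure_of ?P" if g: "g \<in> mspace ?m" for g
    unfolding mtopology_of_def metric_closure_of
  proof (intro CollectI conjI allI impI g)
    fix e :: real assume "e > 0"
    have "continuous_on K g" using g unfolding M by (simp add: continuous_functions_def)
    then obtain p where p: "complex_polynomial p" "\<And>z. z \<in> K \<Longrightarrow> cmod (p (\<chi> k. f k z) - g z) < e / 2"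
      using dense[of g] \<open>e > 0\<close> unfolding poly_approximable_def by (meson half_gt_zero)
    let ?u = "restrict (\<lambda>z. p (\<chi> k. f k z)) K"
    have u: "?u \<in> ?P" using p(1) by blast
    have "mdist ?m g ?u \<le> e / 2"
    proof (rule mdist_cfunspace_le)
      show "0 \<le> e / 2" using \<open>e > 0\<close> by simp
      show "mdist euclidean_metric (g x) (?u x) \<le> e / 2" if "x \<in> topspace (top_of_set K)" for x
        using p(2)[of x] that by (simp add: dist_norm norm_minus_commute less_imp_le)
    qed
    also have "\<dots> < e" using \<open>e > 0\<close> by simp
    finally have "?u \<in> mball g e" unfolding in_mball using g u P by blast
    then show "\<exists>y\<in>?P. y \<in> mball g e" using u by blast
  qed
  moreover have "mtopology_of ?m closure_of ?P \<subseteq> mspace ?m"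
    using closure_of_subset_topspace[of "mtopology_of ?m"] by simp
  ultimately show ?thesis unfolding uniform_algebra_def M[symmetric] by blast
qed

theorem theorem1p8:
  fixes D \<Omega> :: "(complex ^ 'n) set"
    and r :: "'n \<Rightarrow> real"
    and m :: "'n \<Rightarrow> nat"
    and F R :: "complex ^ 'n \<Rightarrow> complex ^ 'n"
    and c :: real
  assumes "\<And>j. 0 < r j"
    and "D = open_polydisc 0 r"
    and "open \<Omega>" and "closure D \<subseteq> \<Omega>"
    and "\<And>j. 1 \<le> m j"
    and "\<And>z j. z \<in> \<Omega> \<Longrightarrow> F z $ j = cnj (z $ j) ^ m j + R z $ j"
    and "0 < c" and "c < 1"
    and "\<And>z \<xi>. z \<in> \<Omega> \<Longrightarrow> \<xi> \<in> \<Omega> \<Longrightarrow>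
           norm (R z - R \<xi>) \<le> c * sqrt (\<Sum>j\<in>UNIV. (cmod ((z $ j) ^ m j - (\<xi> $ j) ^ m j))\<^sup>2)"
  shows "polynomially_convex (graph_over (closure D) F) \<and>
         (C1_smooth_on \<Omega> R \<longrightarrow>
            uniform_algebra
              (case_sum (\<lambda>j z. z $ j) (\<lambda>j z. cnj (z $ j) ^ m j + R z $ j)) (closure D)
            = continuous_functions (closure D))"
proof -
  let ?K = "closed_polydisc r"
  have cl: "closure D = ?K" using closure_open_polydisc[of r] assms(1,2) by simp
  then have sub: "z \<in> \<Omega>" if "z \<in> ?K" for z using assms(4) that by blast
  have F: "F z $ j = cnj (z $ j) ^ m j + R z $ j" if "z \<in> ?K" for z j using assms(6) sub[OF that] .
  have lip: "norm (R z - R \<xi>) \<le> c * norm (coord_powers m z - coord_powers m \<xi>)"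
    if "z \<in> ?K" "\<xi> \<in> ?K" for z \<xi>
  proof -
    have "norm (coord_powers m z - coord_powers m \<xi>) = sqrt (\<Sum>j\<in>UNIV. (cmod ((z $ j) ^ m j - (\<xi> $ j) ^ m j))\<^sup>2)"
      by (simp only: norm_vec_def L2_set_def coord_powers_def vector_minus_component vec_lambda_beta)
    then show ?thesis using assms(9)[OF sub[OF that(1)] sub[OF that(2)]] by (simp only:)
  qed
  have c: "0 \<le> c" "c < 1" using assms(7,8) by auto
  have cR: "continuous_on ?K R"
    unfolding continuous_on_def
  proof
    fix x assume x: "x \<in> ?K"
    have "(coord_powers m \<longlongrightarrow> coord_powers m x) (at x within ?K)"
      using continuous_on_coord_powers[of ?K m] x unfolding continuous_on_def by blast
    then have "((\<lambda>z. c * norm (coord_powers m z - coord_powers m x)) \<longlongrightarrow>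
        c * norm (coord_powers m x - coord_powers m x)) (at x within ?K)"
      by (intro tendsto_intros)
    then have lim: "((\<lambda>z. c * norm (coord_powers m z - coord_powers m x)) \<longlongrightarrow> 0) (at x within ?K)"
      by simp
    have "\<forall>\<^sub>F z in at x within ?K. norm (R z - R x) \<le> c * norm (coord_powers m z - coord_powers m x)"
      unfolding eventually_at_filter by (rule always_eventually) (use lip x in blast)
    then have "((\<lambda>z. R z - R x) \<longlongrightarrow> 0) (at x within ?K)"
      by (rule Lim_null_comparison[OF _ lim])
    then show "(R \<longlongrightarrow> R x) (at x within ?K)" by (simp add: LIM_zero_iff)
  qed
  have "continuous_on ?K (\<lambda>z. \<chi> j. cnj (z $ j) ^ m j + R z $ j)"
    by (intro continuous_on_vec_lambda continuous_intros cR)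
  then have cF: "continuous_on ?K F"
    by (rule continuous_on_eq) (simp add: vec_eq_iff F)
  have "polynomially_convex (graph_over ?K F)"
    by (rule polynomially_convex_graph[OF assms(1) c F lip cF])
  moreover have "uniform_algebra (case_sum (\<lambda>j z. z $ j) (\<lambda>j z. cnj (z $ j) ^ m j + R z $ j)) ?K = continuous_functions ?K"
  proof (rule uniform_algebra_eq_continuous_functions[OF compact_closed_polydisc])
    have "0 \<in> ?K" using assms(1) by (simp add: closed_polydisc_def less_imp_le)
    then show "?K \<noteq> {}" by blast
    show "continuous_on ?K (case k of Inl j \<Rightarrow> \<lambda>z. z $ j | Inr j \<Rightarrow> \<lambda>z. cnj (z $ j) ^ m j + R z $ j)" for k
      by (cases k) (auto intro!: continuous_intros cR)
    fix h :: "complex ^ 'n \<Rightarrow> complex" assume h: "continuous_on ?K h"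
    have "poly_approximable ?K (\<lambda>z. join_vec z (F z)) h"
      by (rule graph_polynomials_dense[OF assms(1,5) c F lip h])
    moreover have "join_vec z (F z) = (\<chi> k. (case k of Inl j \<Rightarrow> \<lambda>z. z $ j | Inr j \<Rightarrow> \<lambda>z. cnj (z $ j) ^ m j + R z $ j) z)"
      if "z \<in> ?K" for z
      using F[OF that] by (auto simp: join_vec_def vec_eq_iff split: sum.split)
    ultimately show "poly_approximable ?K (\<lambda>z. \<chi> k. (case k of Inl j \<Rightarrow> \<lambda>z. z $ j | Inr j \<Rightarrow> \<lambda>z. cnj (z $ j) ^ m j + R z $ j) z) h"
      unfolding poly_approximable_def by simp
  qed
  ultimately show ?thesis unfolding cl by blast
qed

end
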